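(* Let $\lambda:\mathbb{R}\to(0,\infty)$ be a measurable function such that $1/\lambda$ is locally integrable, and suppose there exist two real numbers $a_+,a_->0$ such that $$\lim_{x\to+\infty}\lambda(x)=a_+ \quad\text{and}\quad \lim_{x\to-\infty}\lambda(x)=a_-.$$ Let $B=\{B_t,\,t\ge 0\}$ be a one-dimensional standard Wiener process starting from $0$, let $S_B(u)=\int_0^u \lambda(B_s)^{-1}\,ds$ for $u\ge 0$, and let $\tau_t=\inf\{u>0: S_B(u)>t\}$ for $t\ge 0$. Then on any interval $[0,T]$, $T>0$, the processes $$\left\{\frac{B_{\tau_{nt}}}{\sqrt{n}},\ t\in[0,T]\right\}$$ converge weakly, as $n\to\infty$, to the process $$\left\{W(\eta^{-1}(t)),\ t\in[0,T]\right\},$$ where $W$ is a standard Wiener process starting from $0$, $\eta^{-1}$ is the inverse of the (a.s. continuous and strictly increasing) process $$\eta(t)=\int_0^t\nu(W_s)\,ds,\quad t\ge 0,\qquad\text{and}\qquad \nu(x)=\frac1{a_+}\mathbf 1_{(0,\infty)}(x)+\frac1{a_-}\mathbf 1_{(-\infty,0)}(x).$$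
   Context: Weak convergence on $[0,T]$ means weak convergence of the laws of the continuous stochastic processes, viewed as probability measures on the space $C([0,T])$ of continuous functions with the supremum norm. Convention: $\inf\emptyset=+\infty$. Under the assumptions, $u\mapsto S_B(u)$ is a.s. finite, continuous, strictly increasing and $S_B(\infty)=\infty$ a.s., so that $t\mapsto\tau_t$ is a.s. finite and continuous and $t\mapsto B_{\tau_{nt}}$ has a.s. continuous paths. *)

theory Defs
  imports "HOL-Probability.Probability"
begin

section \<open>Wiener process\<close>

definition wiener_process :: "'a measure \<Rightarrow> (real \<Rightarrow> 'a \<Rightarrow> real) \<Rightarrow> bool" where
  "wiener_process M B \<longleftrightarrow>
     prob_space M \<and>
     (\<forall>t\<ge>0. B t \<in> borel_measurable M) \<and>
     (AE \<omega> in M. B 0 \<omega> = 0) \<and>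
     (AE \<omega> in M. continuous_on {0..} (\<lambda>t. B t \<omega>)) \<and>
     (\<forall>s t. 0 \<le> s \<and> s < t \<longrightarrow>
        distributed M lborel (\<lambda>\<omega>. B t \<omega> - B s \<omega>) (normal_density 0 (sqrt (t - s)))) \<and>
     (\<forall>(n::nat) p. 0 \<le> p 0 \<and> strict_mono_on {..n} p \<longrightarrow>
        prob_space.indep_vars M (\<lambda>_. borel) (\<lambda>i \<omega>. B (p (Suc i)) \<omega> - B (p i) \<omega>) {..<n})"


section \<open>Laws of continuous processes and weak convergence\<close>

definition C_space :: "real \<Rightarrow> (real \<Rightarrow> real) metric" where
  "C_space T = cfunspace (top_of_set {0..T}) euclidean_metric"

definition borel_of :: "'a topology \<Rightarrow> 'a measure" where
  "borel_of X = sigma (topspace X) {U. openin X U}"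

text \<open>Measurability is taken with respect to the completion, so that changing a process on a
  (possibly non-measurable) subset of a null set does not matter.\<close>

definition continuous_process :: "real \<Rightarrow> 'a measure \<Rightarrow> (real \<Rightarrow> 'a \<Rightarrow> real) \<Rightarrow> bool" where
  "continuous_process T M X \<longleftrightarrow>
     prob_space M \<and>
     (\<forall>t\<in>{0..T}. X t \<in> borel_measurable (completion M)) \<and>
     (AE \<omega> in M. continuous_on {0..T} (\<lambda>t. X t \<omega>))"

text \<open>Elements of \<^const>\<open>C_space\<close> are functions restricted to \<open>{0..T}\<close>. On the null set of outcomes
  with a discontinuous path, the path is replaced by the zero function.\<close>

definition path_map :: "real \<Rightarrow> (real \<Rightarrow> 'a \<Rightarrow> real) \<Rightarrow> 'a \<Rightarrow> real \<Rightarrow> real" where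
  "path_map T X \<omega> = (if continuous_on {0..T} (\<lambda>t. X t \<omega>) then restrict (\<lambda>t. X t \<omega>) {0..T}
                 else restrict (\<lambda>_. 0) {0..T})"

definition path_law :: "real \<Rightarrow> 'a measure \<Rightarrow> (real \<Rightarrow> 'a \<Rightarrow> real) \<Rightarrow> (real \<Rightarrow> real) measure" where
  "path_law T M X = distr (completion M) (borel_of (mtopology_of (C_space T))) (path_map T X)"

definition weakly_converges :: "'a topology \<Rightarrow> (nat \<Rightarrow> 'a measure) \<Rightarrow> 'a measure \<Rightarrow> bool" where
  "weakly_converges X \<mu> \<mu>' \<longleftrightarrow>
     (\<forall>f. continuous_map X euclideanreal f \<and> bounded (f ` topspace X) \<longrightarrow>
        (\<lambda>n. \<integral>x. f x \<partial>\<mu> n) \<longlonglongrightarrow> (\<integral>x. f x \<partial>\<mu>'))"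

definition processes_converge_weakly ::
  "real \<Rightarrow> 'a measure \<Rightarrow> (nat \<Rightarrow> real \<Rightarrow> 'a \<Rightarrow> real) \<Rightarrow> 'b measure \<Rightarrow> (real \<Rightarrow> 'b \<Rightarrow> real) \<Rightarrow> bool" where
  "processes_converge_weakly T M X N Y \<longleftrightarrow>
     (\<forall>n. continuous_process T M (X n)) \<and> continuous_process T N Y \<and>
     weakly_converges (mtopology_of (C_space T)) (\<lambda>n. path_law T M (X n)) (path_law T N Y)"


section \<open>Time changes\<close>

definition clock :: "(real \<Rightarrow> real) \<Rightarrow> (real \<Rightarrow> 'a \<Rightarrow> real) \<Rightarrow> real \<Rightarrow> 'a \<Rightarrow> ennreal" where
  "clock lam B u \<omega> = (\<integral>\<^sup>+ s\<in>{0..u}. ennreal (inverse (lam (B s \<omega>))) \<partial>lborel)"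

definition tau :: "(real \<Rightarrow> real) \<Rightarrow> (real \<Rightarrow> 'a \<Rightarrow> real) \<Rightarrow> real \<Rightarrow> 'a \<Rightarrow> ereal" where
  "tau lam B t \<omega> = (INF u\<in>{u. 0 < u \<and> ennreal t < clock lam B u \<omega>}. ereal u)"

text \<open>The coercion \<^const>\<open>real_of_ereal\<close> sends \<open>\<infinity>\<close> to \<open>0\<close>; for the clocks considered here, the time
  change is almost surely finite.\<close>

definition time_changed :: "(real \<Rightarrow> real) \<Rightarrow> (real \<Rightarrow> 'a \<Rightarrow> real) \<Rightarrow> real \<Rightarrow> 'a \<Rightarrow> real" where
  "time_changed lam B t \<omega> = B (real_of_ereal (tau lam B t \<omega>)) \<omega>"

definition nu :: "real \<Rightarrow> real \<Rightarrow> real \<Rightarrow> real" where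
  "nu ap am x = 1 / ap * indicator {0<..} x + 1 / am * indicator {..<0} x"

definition eta :: "real \<Rightarrow> real \<Rightarrow> (real \<Rightarrow> 'b \<Rightarrow> real) \<Rightarrow> real \<Rightarrow> 'b \<Rightarrow> real" where
  "eta ap am W t \<omega> = (LBINT s:{0..t}. nu ap am (W s \<omega>))"

definition eta_inv :: "real \<Rightarrow> real \<Rightarrow> (real \<Rightarrow> 'b \<Rightarrow> real) \<Rightarrow> real \<Rightarrow> 'b \<Rightarrow> real" where
  "eta_inv ap am W t \<omega> = inv_into {0..} (\<lambda>s. eta ap am W s \<omega>) t"

end

theory Submission
  imports Defs
begin

text \<open>
  By Brownian scaling, \<open>B\<^sub>n t = B (n * t) / sqrt n\<close> is again a Wiener
  process, and the rescaled process \<open>B (\<tau> (n * t)) / sqrt n\<close> is the time change of \<open>B\<^sub>n\<close> by the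
  inverse of the clock with the rate \<open>\<lambda>x. lam (sqrt n * x)\<close>
  (\<open>time_changed_brownian_scaling_AE\<close>). Its law is that of the corresponding time change of any
  other Wiener process (\<open>wiener_process_law_unique\<close>, \<open>time_changed_law_unique\<close>), in particular of
  the fixed process \<open>W\<close>. So all the processes may be realised on the space of \<open>W\<close>, driven by the
  same path, where only the rate depends on \<open>n\<close>; it tends pointwise, away from \<open>0\<close>, to the step
  function with the values \<open>ap\<close> and \<open>am\<close>.

  On that space the clocks converge in a strong sense. The difference of the reciprocals of \<open>lam\<close>
  and of the step function is small outside a compact set, and on it integrable. Since \<open>W s\<close> has a
  density of order \<open>1 / sqrt s\<close>, the expected discounted time integral of this difference along
  \<open>sqrt n * W\<close> is at most \<open>e + H / sqrt n\<close> (\<open>wiener_process_discounted_occupation_le\<close>). Thus the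
  clocks converge locally uniformly in probability, and almost surely along subsequences
  (\<open>clock_defect_subseq_AE_tendsto_0\<close>). For a path along which they converge, the inverses converge
  uniformly on \<open>{0..T}\<close> (\<open>inv_regular_clock_uniform_limit\<close>), hence so do the time-changed paths, and
  dominated convergence yields the convergence of expectations of bounded continuous functionals.

  The same estimate shows that the clocks are finite and, applied to the rescalings of a single
  process, that they grow to infinity (\<open>clock_unbounded_AE\<close>). The limit process is itself a time
  change: \<open>eta\<close> is the clock of the step function, as a Wiener process spends no time at \<open>0\<close>
  (\<open>eta_eq_clock_AE\<close>).

  The transfer of laws requires genuine measurability. Clocks and time changes are therefore
  computed on the product space of all functions on the half-line, with a jointly measurable
  version of the evaluation map, and continuous functionals on the space of paths are written as
  limits of functions of finitely many rounded samples of the path.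
\<close>

section \<open>Measurability and continuity of functionals of paths\<close>

lemma continuous_on_imp_path_in_C_space:
  fixes y :: "real \<Rightarrow> real"
  assumes "continuous_on {0..T} y"
  shows "restrict y {0..T} \<in> mspace (C_space T)"
proof -
  have c: "continuous_on {0..T} (restrict y {0..T})"
    using assms by (simp cong: continuous_on_cong_simp)
  have "bounded (restrict y {0..T} ` {0..T})"
    by (intro compact_imp_bounded compact_continuous_image c) simp
  with c show ?thesis
    by (simp add: C_space_def)
qed

lemma path_map_eq_restrict:
  "continuous_on {0..T} (\<lambda>t. X t \<omega>) \<Longrightarrow> path_map T X \<omega> = restrict (\<lambda>t. X t \<omega>) {0..T}"
  by (simp add: path_map_def)

lemma path_map_in_C_space: "path_map T X \<omega> \<in> mspace (C_space T)"
  by (auto simp: path_map_def intro!: continuous_on_imp_path_in_C_space)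

text \<open>Uniform convergence on \<open>{0..T}\<close> is convergence in \<^const>\<open>C_space\<close>, so continuous functionals pass
  to the limit. This is how convergence of paths enters weak convergence.\<close>

lemma continuous_functional_LIMSEQ:
  fixes y :: "real \<Rightarrow> real" and z :: "nat \<Rightarrow> real \<Rightarrow> real"
  assumes f: "continuous_map (mtopology_of (C_space T)) euclideanreal f"
    and y: "continuous_on {0..T} y" and z: "\<And>n. continuous_on {0..T} (z n)"
    and lim: "uniform_limit {0..T} z y sequentially"
  shows "(\<lambda>n. f (restrict (z n) {0..T})) \<longlonglongrightarrow> f (restrict y {0..T})"
proof -
  interpret C: Metric_space "mspace (C_space T)" "mdist (C_space T)"
    by (rule Metric_space_mspace_mdist)
  have "limitin (mtopology_of (C_space T)) (\<lambda>n. restrict (z n) {0..T}) (restrict y {0..T}) sequentially"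
    unfolding mtopology_of_def C.limitin_metric
  proof (intro conjI allI impI)
    show "restrict y {0..T} \<in> mspace (C_space T)"
      by (rule continuous_on_imp_path_in_C_space[OF y])
    fix e :: real assume e: "e > 0"
    have "\<forall>\<^sub>F n in sequentially. \<forall>t\<in>{0..T}. dist (z n t) (y t) < e / 2"
      using lim half_gt_zero[OF e] unfolding uniform_limit_iff by blast
    then show "\<forall>\<^sub>F n in sequentially. restrict (z n) {0..T} \<in> mspace (C_space T) \<and>
        mdist (C_space T) (restrict (z n) {0..T}) (restrict y {0..T}) < e"
    proof eventually_elim
      case (elim n)
      have "mdist (C_space T) (restrict (z n) {0..T}) (restrict y {0..T}) \<le> e / 2"
        unfolding C_space_def
        by (rule mdist_cfunspace_le) (use elim e in \<open>auto simp: less_imp_le\<close>)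
      then show ?case
        using e continuous_on_imp_path_in_C_space[OF z] by auto
    qed
  qed
  from continuous_map_limit[OF f this] show ?thesis
    by (simp add: comp_def)
qed

text \<open>Bernstein polynomials whose coefficients are rounded down to multiples of \<open>1/n\<close>. For given \<open>n\<close>
  they take only countably many values as functions of the path, hence every functional of them,
  continuous or not, is measurable as soon as the finitely many sampled values are. This replaces
  the separability of the space of continuous functions.\<close>

definition rounded_Bernstein :: "real \<Rightarrow> nat \<Rightarrow> (real \<Rightarrow> real) \<Rightarrow> real \<Rightarrow> real" where
  "rounded_Bernstein T n y t =
     (\<Sum>k\<le>n. of_int \<lfloor>real n * y (T * (k / n))\<rfloor> / n * Bernstein n k (t / T))"

lemma uniform_limit_rounded_Bernstein:
  assumes T: "0 < T" and y: "continuous_on {0..T} y"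
  shows "uniform_limit {0..T} (\<lambda>n. rounded_Bernstein T n y) y sequentially"
proof (rule uniform_limitI)
  fix e :: real assume e: "e > 0"
  have "continuous_on {0..1} (\<lambda>x. y (T * x))"
    using T by (intro continuous_on_compose2[OF y] continuous_intros)
      (auto intro!: mult_left_le)
  from Bernstein_Weierstrass[OF this, of "e / 2"] e obtain N where
    N: "\<And>n x. N \<le> n \<and> x \<in> {0..1} \<Longrightarrow>
        \<bar>y (T * x) - (\<Sum>k\<le>n. y (T * (k / n)) * Bernstein n k x)\<bar> < e / 2"
    by auto
  obtain N' where N': "N' > 0" "1 / real N' < e / 2"
    using e reals_Archimedean[of "e/2"]
    by (auto simp only: inverse_eq_divide half_gt_zero zero_less_Suc)
  show "\<forall>\<^sub>F n in sequentially. \<forall>t\<in>{0..T}. dist (rounded_Bernstein T n y t) (y t) < e"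
    using eventually_ge_at_top[of "max N N'"]
  proof eventually_elim
    case (elim n)
    then have n: "n \<ge> N" "n > 0" using N' by auto
    have "1 / real n \<le> 1 / real N'" using elim N' by (intro divide_left_mono) auto
    then have ne: "1 / real n < e / 2" using N' by linarith
    show ?case
    proof
      fix t assume t: "t \<in> {0..T}"
      let ?x = "t / T"
      have x: "?x \<in> {0..1}" using t T by auto
      have "\<bar>(\<Sum>k\<le>n. y (T * (k / n)) * Bernstein n k ?x) - rounded_Bernstein T n y t\<bar>
          = \<bar>\<Sum>k\<le>n. (y (T * (k / n)) - of_int \<lfloor>real n * y (T * (k / n))\<rfloor> / n) * Bernstein n k ?x\<bar>"
        by (simp add: rounded_Bernstein_def sum_subtractf left_diff_distrib)
      also have "\<dots> \<le> (\<Sum>k\<le>n. (1 / n) * Bernstein n k ?x)"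
      proof (rule order.trans[OF sum_abs sum_mono], subst abs_mult, intro mult_mono)
        fix k :: nat
        let ?a = "y (T * (k / n))"
        have "\<bar>real n * ?a - of_int \<lfloor>real n * ?a\<rfloor>\<bar> / n \<le> 1 / n"
          by (rule divide_right_mono) (linarith, simp)
        also have "\<bar>real n * ?a - of_int \<lfloor>real n * ?a\<rfloor>\<bar> / n = \<bar>(real n * ?a - of_int \<lfloor>real n * ?a\<rfloor>) / n\<bar>"
          by (simp add: abs_divide)
        also have "(real n * ?a - of_int \<lfloor>real n * ?a\<rfloor>) / n = ?a - of_int \<lfloor>real n * ?a\<rfloor> / n"
          using n by (simp add: diff_divide_distrib)
        finally show "\<bar>?a - of_int \<lfloor>real n * ?a\<rfloor> / n\<bar> \<le> 1 / n" .
        show "\<bar>Bernstein n k ?x\<bar> \<le> Bernstein n k ?x"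
          using x by (subst abs_of_nonneg) (auto intro!: Bernstein_nonneg)
      qed auto
      also have "\<dots> = 1 / n"
        by (simp only: sum_Bernstein mult_1_right flip: sum_distrib_left)
      finally have "\<bar>(\<Sum>k\<le>n. y (T * (k / n)) * Bernstein n k ?x) - rounded_Bernstein T n y t\<bar> \<le> 1 / n" .
      moreover have "\<bar>y t - (\<Sum>k\<le>n. y (T * (k / n)) * Bernstein n k ?x)\<bar> < e / 2"
        using N[of n ?x] n x T by simp
      ultimately show "dist (rounded_Bernstein T n y t) (y t) < e"
        unfolding dist_real_def using ne by linarith
    qed
  qed
qed

lemma continuous_on_rounded_Bernstein: "continuous_on {0..T} (rounded_Bernstein T n y)"
  unfolding rounded_Bernstein_def Bernstein_def divide_inverse[of _ T] by (intro continuous_intros)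

text \<open>The functional factors through the list \<open>v\<close> of rounded samples, and all functions on the
  countable type of integer lists are measurable.\<close>

lemma borel_measurable_functional_rounded_Bernstein:
  assumes T: "0 < T" and X: "\<And>t. t \<in> {0..T} \<Longrightarrow> X t \<in> borel_measurable M"
  shows "(\<lambda>\<omega>. f (restrict (rounded_Bernstein T n (\<lambda>t. X t \<omega>)) {0..T}) :: real) \<in> borel_measurable M"
proof -
  define v :: "'a \<Rightarrow> int list" where "v = (\<lambda>\<omega>. map (\<lambda>k. \<lfloor>real n * X (T * (k / n)) \<omega>\<rfloor>) [0..<Suc n])"
  have fl: "(\<lambda>\<omega>. \<lfloor>real n * X (T * (k / n)) \<omega>\<rfloor>) \<in> measurable M (count_space UNIV)" if "k \<le> n" for k
  proof -
    have "T * (k / n) \<in> {0..T}"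
      using T that by (auto simp: mult_le_cancel_left2 divide_le_eq_1 simp del: times_divide_eq_right)
    note X[OF this, measurable]
    show ?thesis by measurable
  qed
  have "v \<in> measurable M (count_space UNIV)"
  proof -
    have "v -` {l} \<inter> space M \<in> sets M" for l
    proof (cases "length l = Suc n")
      case True
      have "v -` {l} \<inter> space M =
          {\<omega>\<in>space M. \<forall>k\<in>{..n}. \<lfloor>real n * X (T * (k / n)) \<omega>\<rfloor> = l ! k}"
        using True by (auto simp: v_def list_eq_iff_nth_eq less_Suc_eq_le simp del: upt_Suc)
      also have "\<dots> \<in> sets M"
      proof (intro sets.sets_Collect_finite_All)
        fix k assume "k \<in> {..n}"
        then have "k \<le> n" by simp
        note fl[OF this, measurable]
        show "{\<omega> \<in> space M. \<lfloor>real n * X (T * (k / n)) \<omega>\<rfloor> = l ! k} \<in> sets M" by measurable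
      qed auto
      finally show ?thesis .
    next
      case False
      then have "v -` {l} \<inter> space M = {}" by (auto simp: v_def)
      then show ?thesis by simp
    qed
    then show ?thesis by (auto simp: measurable_count_space_eq2_countable)
  qed
  moreover have "(\<lambda>\<omega>. f (restrict (rounded_Bernstein T n (\<lambda>t. X t \<omega>)) {0..T})) =
      (\<lambda>l. f (restrict (\<lambda>t. \<Sum>k\<le>n. of_int (l ! k) / n * Bernstein n k (t / T)) {0..T})) \<circ> v"
    by (auto simp: fun_eq_iff rounded_Bernstein_def v_def less_Suc_eq_le restrict_def
        simp del: upt_Suc intro!: arg_cong[where f=f] sum.cong)
  ultimately show ?thesis
    by (simp only:) (rule measurable_comp, assumption, simp)
qed

text \<open>A version of a continuous functional \<open>f\<close> that is defined for all functions \<open>y\<close>, agrees with \<open>f\<close>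
  on continuous ones, and depends measurably on the values of \<open>y\<close> without any exceptional set
  (on discontinuous functions it has a meaningless value).\<close>

definition path_functional :: "real \<Rightarrow> ((real \<Rightarrow> real) \<Rightarrow> real) \<Rightarrow> (real \<Rightarrow> real) \<Rightarrow> real" where
  "path_functional T f y = lim (\<lambda>n. f (restrict (rounded_Bernstein T n y) {0..T}))"

lemma path_functional_eq:
  assumes "0 < T" "continuous_map (mtopology_of (C_space T)) euclideanreal f"
    and "continuous_on {0..T} y"
  shows "path_functional T f y = f (restrict y {0..T})"
  unfolding path_functional_def
  by (intro limI continuous_functional_LIMSEQ[OF assms(2,3)] continuous_on_rounded_Bernstein
      uniform_limit_rounded_Bernstein[OF assms(1,3)])

lemma path_functional_measurable:
  assumes "0 < T" and "\<And>t. t \<in> {0..T} \<Longrightarrow> X t \<in> borel_measurable M"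
  shows "(\<lambda>\<omega>. path_functional T f (\<lambda>t. X t \<omega>)) \<in> borel_measurable M"
  unfolding path_functional_def
  by (intro borel_measurable_lim_metric borel_measurable_functional_rounded_Bernstein assms)

lemma borel_measurable_completion_AE:
  fixes g h :: "'a \<Rightarrow> real"
  assumes g: "g \<in> borel_measurable (completion M)" and ae: "AE x in M. g x = h x"
  shows "h \<in> borel_measurable (completion M)"
proof (rule measurableI)
  fix A :: "real set" assume A: "A \<in> sets borel"
  have "AE x in completion M. x \<in> g -` A \<inter> space (completion M) \<longleftrightarrow> x \<in> h -` A \<inter> space (completion M)"
    using AE_completion[OF ae] by eventually_elim auto
  then show "h -` A \<inter> space (completion M) \<in> sets (completion M)"
    by (rule completion.in_sets_AE) (use measurable_sets[OF g A] in auto)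
qed simp

lemma space_borel_of [simp]: "space (borel_of X) = topspace X"
  unfolding borel_of_def by (rule space_measure_of) (use openin_subset in blast)

lemma sets_borel_of: "sets (borel_of X) = sigma_sets (topspace X) {U. openin X U}"
  unfolding borel_of_def by (rule sets_measure_of) (use openin_subset in blast)

lemma continuous_map_borel_measurable:
  assumes "continuous_map X euclideanreal f"
  shows "f \<in> borel_measurable (borel_of X)"
proof (rule borel_measurableI)
  fix S :: "real set" assume "open S"
  then have "openin X {x \<in> topspace X. f x \<in> S}"
    using assms by (auto simp: continuous_map)
  moreover have "f -` S \<inter> topspace X = {x \<in> topspace X. f x \<in> S}" by auto
  ultimately show "f -` S \<inter> space (borel_of X) \<in> sets (borel_of X)"
    by (auto simp: sets_borel_of)
qed

text \<open>An open set \<open>U\<close> of a metric space is the set where the distance to its complement is positive,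
  and this distance is a continuous real function.\<close>

lemma measurable_borel_of_mtopology:
  assumes g: "\<And>x. x \<in> space M \<Longrightarrow> g x \<in> mspace m"
    and meas: "\<And>f. continuous_map (mtopology_of m) euclideanreal f \<Longrightarrow> (\<lambda>x. f (g x)) \<in> borel_measurable M"
  shows "g \<in> measurable M (borel_of (mtopology_of m))"
proof (rule measurable_sigma_sets[OF sets_borel_of])
  interpret m: Metric_space "mspace m" "mdist m" by (rule Metric_space_mspace_mdist)
  fix U assume "U \<in> {U. openin (mtopology_of m) U}"
  then have U: "openin (mtopology_of m) U" by simp
  show "g -` U \<inter> space M \<in> sets M"
  proof (cases "mspace m - U = {}")
    case True
    then have "g -` U \<inter> space M = space M" using g by blast
    then show ?thesis by simp
  next
    case False
    define f where "f = (\<lambda>x. INF y\<in>mspace m - U. mdist m x y)"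
    have bdd: "bdd_below ((\<lambda>y. mdist m x y) ` (mspace m - U))" for x
      by (rule bdd_belowI[of _ 0]) auto
    have lip: "f x \<le> f x' + mdist m x x'" if "x \<in> mspace m" "x' \<in> mspace m" for x x'
    proof -
      have "f x - mdist m x x' \<le> f x'"
        unfolding f_def
      proof (rule cINF_greatest[OF False])
        fix y assume y: "y \<in> mspace m - U"
        have "(INF y\<in>mspace m - U. mdist m x y) \<le> mdist m x y"
          by (rule cINF_lower[OF bdd y])
        also have "\<dots> \<le> mdist m x x' + mdist m x' y"
          using y that by (intro m.triangle) auto
        finally show "(INF y\<in>mspace m - U. mdist m x y) - mdist m x x' \<le> mdist m x' y" by simp
      qed
      then show ?thesis by simp
    qed
    have "\<bar>f x - f x'\<bar> \<le> 1 * mdist m x x'" if "x \<in> mspace m" "x' \<in> mspace m" for x x'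
      using lip[OF that] lip[OF that(2,1)] m.commute[of x x'] by simp
    then have "Lipschitz_continuous_map m euclidean_metric f"
      unfolding Lipschitz_continuous_map_def
      by (intro conjI exI[of _ 1]) (auto simp: dist_real_def)
    then have "continuous_map (mtopology_of m) euclideanreal f"
      using Lipschitz_continuous_imp_continuous_map[of m euclidean_metric f] by simp
    note meas[OF this, measurable]
    have pos: "f x > 0 \<longleftrightarrow> x \<in> U" if x: "x \<in> mspace m" for x
    proof
      assume "f x > 0"
      show "x \<in> U"
      proof (rule ccontr)
        assume "x \<notin> U"
        then have "f x \<le> mdist m x x"
          unfolding f_def using x by (intro cINF_lower[OF bdd]) auto
        then show False using \<open>f x > 0\<close> x by simp
      qed
    next
      assume "x \<in> U"
      then obtain r where r: "r > 0" "m.mball x r \<subseteq> U"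
        using U by (auto simp: mtopology_of_def m.openin_mtopology)
      have "r \<le> f x"
        unfolding f_def
      proof (rule cINF_greatest[OF False])
        fix y assume y: "y \<in> mspace m - U"
        then have "y \<notin> m.mball x r" using r by auto
        then show "r \<le> mdist m x y" using x y by (auto simp: m.in_mball)
      qed
      then show "f x > 0" using r by simp
    qed
    have "g -` U \<inter> space M = {x \<in> space M. f (g x) > 0}"
      using pos g by auto
    then show ?thesis by simp
  qed
next
  show "{U. openin (mtopology_of m) U} \<subseteq> Pow (topspace (mtopology_of m))"
    using openin_subset by blast
  show "g \<in> space M \<rightarrow> topspace (mtopology_of m)"
    using g by simp
qed

lemma path_functional_path_map:
  assumes "0 < T" "continuous_map (mtopology_of (C_space T)) euclideanreal f"
    and "continuous_on {0..T} (\<lambda>t. X t \<omega>)"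
  shows "f (path_map T X \<omega>) = path_functional T f (\<lambda>t. X t \<omega>)"
  using assms by (simp add: path_functional_eq path_map_eq_restrict)

text \<open>The completion absorbs the outcomes with a discontinuous path, on which \<^const>\<open>path_functional\<close>
  and \<^const>\<open>path_map\<close> need not agree.\<close>

lemma measurable_functional_path_map:
  assumes T: "0 < T" and X: "continuous_process T M X"
    and f: "continuous_map (mtopology_of (C_space T)) euclideanreal f"
  shows "(\<lambda>\<omega>. f (path_map T X \<omega>)) \<in> borel_measurable (completion M)"
proof -
  have X': "X t \<in> borel_measurable (completion M)" if "t \<in> {0..T}" for t
    using X that by (auto simp: continuous_process_def)
  have "AE \<omega> in M. continuous_on {0..T} (\<lambda>t. X t \<omega>)"
    using X by (simp add: continuous_process_def)
  then have ae: "AE \<omega> in M. path_functional T f (\<lambda>t. X t \<omega>) = f (path_map T X \<omega>)"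
    by eventually_elim (simp add: path_functional_path_map[OF T f])
  show ?thesis
    by (rule borel_measurable_completion_AE[OF path_functional_measurable[OF T X'] ae])
qed

lemma measurable_path_map:
  assumes T: "0 < T" and X: "continuous_process T M X"
  shows "path_map T X \<in> measurable (completion M) (borel_of (mtopology_of (C_space T)))"
  by (intro measurable_borel_of_mtopology path_map_in_C_space measurable_functional_path_map[OF T X])

lemma integral_path_law:
  assumes T: "0 < T" and X: "continuous_process T M X"
    and f: "continuous_map (mtopology_of (C_space T)) euclideanreal f"
  shows "(\<integral>y. f y \<partial>path_law T M X) = (\<integral>\<omega>. f (path_map T X \<omega>) \<partial>completion M)"
  unfolding path_law_def
  by (rule integral_distr[OF measurable_path_map[OF T X] continuous_map_borel_measurable[OF f]])

section \<open>The law of a Wiener process on path space\<close>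

text \<open>Recovers \<open>y s\<close> from the values of \<open>y\<close> at nonnegative rational times, provided \<open>y\<close> is continuous.
  Unlike evaluation, it is jointly measurable in \<open>s\<close> and \<open>y\<close> on the product space: a limit of
  functions that choose among countably many coordinates.\<close>

definition path_ext :: "(real \<Rightarrow> real) \<Rightarrow> real \<Rightarrow> real" where
  "path_ext y s = lim (\<lambda>j. y (real (nat \<lfloor>real (Suc j) * s\<rfloor>) / real (Suc j)))"

lemma path_ext_cong: "(\<And>t. t \<ge> 0 \<Longrightarrow> y t = z t) \<Longrightarrow> path_ext y = path_ext z"
  by (auto simp: path_ext_def fun_eq_iff)

lemma path_ext_eq:
  assumes y: "continuous_on {0..} y" and s: "s \<ge> 0"
  shows "path_ext y s = y s"
proof -
  let ?q = "\<lambda>j. real (nat \<lfloor>real (Suc j) * s\<rfloor>) / real (Suc j)"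
  have "?q \<longlonglongrightarrow> s"
  proof (rule real_tendsto_sandwich[of "\<lambda>j. s - 1 / real (Suc j)" _ _ "\<lambda>_. s"])
    have *: "?q j \<le> s \<and> s - 1 / real (Suc j) \<le> ?q j" for j
    proof -
      have "0 \<le> \<lfloor>real (Suc j) * s\<rfloor>" using s by simp
      then have eq: "real (nat \<lfloor>real (Suc j) * s\<rfloor>) = of_int \<lfloor>real (Suc j) * s\<rfloor>" by simp
      have "real (nat \<lfloor>real (Suc j) * s\<rfloor>) \<le> s * real (Suc j)"
        "s * real (Suc j) - 1 \<le> real (nat \<lfloor>real (Suc j) * s\<rfloor>)"
        unfolding eq mult.commute[of s] by linarith+
      then have "?q j \<le> s" "(s * real (Suc j) - 1) / real (Suc j) \<le> ?q j"
        by (auto simp: pos_divide_le_eq intro!: divide_right_mono)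
      then show ?thesis by (auto simp: diff_divide_distrib)
    qed
    then show "\<forall>\<^sub>F j in sequentially. ?q j \<le> s" "\<forall>\<^sub>F j in sequentially. s - 1 / real (Suc j) \<le> ?q j"
      by auto
    have "(\<lambda>j. s - 1 / real (Suc j)) \<longlonglongrightarrow> s - 0"
      by (intro tendsto_intros LIMSEQ_Suc[OF lim_1_over_n])
    then show "(\<lambda>j. s - 1 / real (Suc j)) \<longlonglongrightarrow> s" by simp
  qed simp
  then have "(\<lambda>j. y (?q j)) \<longlonglongrightarrow> y s"
    using y s by (intro continuous_on_tendsto_compose[OF y]) auto
  then show ?thesis
    unfolding path_ext_def by (rule limI)
qed

abbreviation path_space :: "(real \<Rightarrow> real) measure" where
  "path_space \<equiv> Pi\<^sub>M {0..} (\<lambda>_. borel)"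

lemma measurable_path_ext:
  "(\<lambda>(s, y). path_ext y s) \<in> borel_measurable (borel \<Otimes>\<^sub>M path_space)"
proof -
  have "(\<lambda>x. snd x (real (nat \<lfloor>real (Suc j) * fst x\<rfloor>) / real (Suc j)))
      \<in> borel_measurable (borel \<Otimes>\<^sub>M path_space)" for j
  proof (rule measurable_compose_countable[where f="\<lambda>i x. snd x (real i / real (Suc j))"])
    fix i :: nat
    have "(\<lambda>y. y (real i / real (Suc j))) \<in> borel_measurable path_space"
      by (rule measurable_component_singleton) auto
    from measurable_compose[OF measurable_snd this]
    show "(\<lambda>x. snd x (real i / real (Suc j))) \<in> borel_measurable (borel \<Otimes>\<^sub>M path_space)" .
  qed measurable
  then show ?thesis
    unfolding path_ext_def case_prod_unfold by measurable
qed

lemma measurable_path_ext_compose [measurable (raw)]: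
  assumes "f \<in> borel_measurable M" and "g \<in> measurable M path_space"
  shows "(\<lambda>x. path_ext (g x) (f x)) \<in> borel_measurable M"
  using measurable_compose[OF measurable_Pair[OF assms] measurable_path_ext] by simp

definition path_of :: "(real \<Rightarrow> 'a \<Rightarrow> real) \<Rightarrow> 'a \<Rightarrow> real \<Rightarrow> real" where
  "path_of B \<omega> = (\<lambda>t\<in>{0..}. B t \<omega>)"

lemma measurable_path_of:
  assumes "wiener_process M B"
  shows "path_of B \<in> measurable M path_space"
  unfolding path_of_def using assms
  by (intro measurable_restrict) (auto simp: wiener_process_def)

lemma path_ext_path_of_eq:
  assumes "continuous_on {0..} (\<lambda>t. B t \<omega>)" "s \<ge> 0"
  shows "path_ext (path_of B \<omega>) s = B s \<omega>"
  unfolding path_of_def using path_ext_eq[OF assms] 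
  by (subst path_ext_cong[of _ "\<lambda>t. B t \<omega>"]) auto

text \<open>The evaluation process on path space. Functionals of a process such as clocks and time changes
  are measurable without exceptional sets when computed for the coordinate process; for an
  almost surely continuous process \<open>B\<close> they agree almost surely with those of \<open>B\<close>.\<close>

abbreviation (input) coordinate_process :: "real \<Rightarrow> (real \<Rightarrow> real) \<Rightarrow> real" where
  "coordinate_process \<equiv> \<lambda>s y. path_ext y s"

lemma wiener_process_continuous_path:
  "wiener_process M B \<Longrightarrow> AE \<omega> in M. continuous_on {0..} (\<lambda>t. B t \<omega>)"
  by (simp add: wiener_process_def)

lemma wiener_process_coordinate:
  assumes "wiener_process M B"
  shows "AE \<omega> in M. \<forall>s\<ge>0. B s \<omega> = coordinate_process s (path_of B \<omega>)"
  using wiener_process_continuous_path[OF assms] by eventually_elim (simp add: path_ext_path_of_eq)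

text \<open>Partial sums of the increments recover the process at the times \<open>p i\<close>, because it starts at \<open>0\<close>;
  and the law of the increments is a product of normal laws that involves only \<open>p\<close>.\<close>

lemma wiener_process_finite_dim:
  fixes p :: "nat \<Rightarrow> real"
  assumes W: "wiener_process M B" and p: "p 0 = 0" "strict_mono_on {..n} p" and n: "n > 0"
  shows "distr M (Pi\<^sub>M {..n} (\<lambda>_. borel)) (\<lambda>\<omega>. \<lambda>i\<in>{..n}. B (p i) \<omega>) =
    distr (Pi\<^sub>M {..<n} (\<lambda>i. density lborel (normal_density 0 (sqrt (p (Suc i) - p i)))))
      (Pi\<^sub>M {..n} (\<lambda>_. borel)) (\<lambda>y. \<lambda>i\<in>{..n}. \<Sum>j<i. y j)"
    (is "distr M ?N ?B = distr ?G ?N ?\<Phi>")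
proof -
  interpret prob_space M using W by (simp add: wiener_process_def)
  let ?D = "\<lambda>i \<omega>. B (p (Suc i)) \<omega> - B (p i) \<omega>"
  let ?N' = "Pi\<^sub>M {..<n} (\<lambda>_. borel) :: (nat \<Rightarrow> real) measure"
  have p0: "p i \<ge> 0" if "i \<le> n" for i
    using strict_mono_onD[OF p(2), of 0 i] p(1) that by (cases "i = 0") auto
  have Bm: "B (p i) \<in> borel_measurable M" if "i \<le> n" for i
    using W p0[OF that] by (simp add: wiener_process_def)
  have Dm: "?D i \<in> borel_measurable M" if "i < n" for i
    using Bm[of i] Bm[of "Suc i"] that by auto
  have \<Phi>: "?\<Phi> \<in> measurable ?N' ?N"
    by (intro measurable_restrict borel_measurable_sum measurable_component_singleton) auto
  have ind: "indep_vars (\<lambda>_. borel) ?D {..<n}"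
    using W p unfolding wiener_process_def by auto
  have "distr M ?N' (\<lambda>\<omega>. \<lambda>i\<in>{..<n}. ?D i \<omega>) = Pi\<^sub>M {..<n} (\<lambda>i. distr M borel (?D i))"
    by (subst indep_vars_iff_distr_eq_PiM'[symmetric]) (use n Dm ind in \<open>auto simp: lessThan_empty_iff\<close>)
  also have "\<dots> = ?G"
  proof (intro PiM_cong refl)
    fix i assume i: "i \<in> {..<n}"
    then have "p i < p (Suc i)" using strict_mono_onD[OF p(2), of i "Suc i"] by simp
    then have "distributed M lborel (?D i) (normal_density 0 (sqrt (p (Suc i) - p i)))"
      using W p0[of i] i unfolding wiener_process_def by auto
    from distributed_distr_eq_density[OF this]
    show "distr M borel (?D i) = density lborel (normal_density 0 (sqrt (p (Suc i) - p i)))"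
      by (simp cong: distr_cong)
  qed
  finally have G: "distr M ?N' (\<lambda>\<omega>. \<lambda>i\<in>{..<n}. ?D i \<omega>) = ?G" .
  have Dm': "(\<lambda>\<omega>. \<lambda>i\<in>{..<n}. ?D i \<omega>) \<in> measurable M ?N'"
    using Dm by (intro measurable_restrict) auto
  have "distr M ?N ?B = distr M ?N (?\<Phi> \<circ> (\<lambda>\<omega>. \<lambda>i\<in>{..<n}. ?D i \<omega>))"
  proof (rule distr_cong_AE)
    have "AE \<omega> in M. B 0 \<omega> = 0" using W by (simp add: wiener_process_def)
    then show "AE \<omega> in M. ?B \<omega> = (?\<Phi> \<circ> (\<lambda>\<omega>. \<lambda>i\<in>{..<n}. ?D i \<omega>)) \<omega>"
    proof eventually_elim
      case (elim \<omega>)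
      have "(\<Sum>j<i. restrict (\<lambda>i. ?D i \<omega>) {..<n} j) = B (p i) \<omega>" if "i \<le> n" for i
      proof -
        have "(\<Sum>j<i. restrict (\<lambda>i. ?D i \<omega>) {..<n} j) = (\<Sum>j<i. ?D j \<omega>)"
          using that by (intro sum.cong) auto
        also have "\<dots> = B (p i) \<omega> - B (p 0) \<omega>"
          by (rule sum_lessThan_telescope)
        finally show ?thesis using elim p(1) by simp
      qed
      then show ?case by (auto simp: fun_eq_iff)
    qed
  qed (use Bm \<Phi> Dm' in \<open>auto intro!: measurable_restrict measurable_comp\<close>)
  also have "\<dots> = distr (distr M ?N' (\<lambda>\<omega>. \<lambda>i\<in>{..<n}. ?D i \<omega>)) ?N ?\<Phi>"
    by (rule distr_distr[OF \<Phi> Dm', symmetric])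
  finally show ?thesis unfolding G .
qed

text \<open>The times \<open>0\<close> and \<open>1\<close> are added so that the enumeration starts at \<open>0\<close> and has at least one
  increment.\<close>

lemma finite_set_enumeration_from_0:
  fixes J :: "real set"
  assumes "finite J" "J \<subseteq> {0..}"
  obtains p :: "nat \<Rightarrow> real" and n where
    "p 0 = 0" "strict_mono_on {..n} p" "n > 0" "J \<subseteq> p ` {..n}"
proof -
  define L where "L = sorted_list_of_set (insert 0 (insert 1 J))"
  have fin: "finite (insert 0 (insert 1 J))" using assms by simp
  have set: "set L = insert 0 (insert 1 J)" unfolding L_def by (rule set_sorted_list_of_set[OF fin])
  have sorted: "sorted_wrt (<) L" unfolding L_def by (rule strict_sorted_list_of_set)
  have "card {0, 1::real} \<le> card (insert 0 (insert 1 J))" using fin by (intro card_mono) auto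
  then have len: "length L \<ge> 2" by (simp add: L_def)
  obtain k where k: "k < length L" "L ! k = 0" using set by (metis in_set_conv_nth insertI1)
  have "L ! 0 \<in> set L" using len by (intro nth_mem) auto
  then have "L ! 0 \<ge> 0" using set assms by auto
  moreover have "L ! 0 \<le> L ! k"
    using sorted_wrt_nth_less[OF sorted, of 0 k] k by (cases "k = 0") auto
  ultimately have "L ! 0 = 0" using k by simp
  moreover have "strict_mono_on {..length L - 1} (\<lambda>i. L ! i)"
    using len by (auto intro!: strict_mono_onI sorted_wrt_nth_less[OF sorted])
  moreover have "J \<subseteq> (\<lambda>i. L ! i) ` {..length L - 1}"
  proof
    fix x assume "x \<in> J"
    then obtain i where "i < length L" "L ! i = x" using set by (metis in_set_conv_nth insertI2)
    then show "x \<in> (\<lambda>i. L ! i) ` {..length L - 1}" by (intro image_eqI[of _ _ i]) auto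
  qed
  ultimately show ?thesis using len by (intro that[of "\<lambda>i. L ! i" "length L - 1"]) auto
qed

text \<open>The probability of a cylinder is read off from the finite-dimensional law along an enumeration \<open>p\<close>
  of times that covers its base.\<close>

lemma emeasure_path_of_cylinder:
  fixes p :: "nat \<Rightarrow> real" and A :: "real \<Rightarrow> real set" and J :: "real set"
  assumes B: "wiener_process M B" and p: "\<And>i. i \<le> n \<Longrightarrow> p i \<ge> 0" "J \<subseteq> p ` {..n}"
    and J: "finite J" "J \<subseteq> {0..}" and A: "\<And>i. i \<in> J \<Longrightarrow> A i \<in> sets borel"
  shows "emeasure (distr M path_space (path_of B)) (prod_emb {0..} (\<lambda>_. borel) J (Pi\<^sub>E J A)) =
    emeasure (distr M (Pi\<^sub>M {..n} (\<lambda>_. borel)) (\<lambda>\<omega>. \<lambda>i\<in>{..n}. B (p i) \<omega>))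
      (Pi\<^sub>E {..n} (\<lambda>i. if p i \<in> J then A (p i) else UNIV))"
    (is "emeasure _ ?X = emeasure (distr M ?N _) ?E")
proof -
  have X: "?X \<in> sets path_space" using J A by (intro sets_PiM_I) auto
  have E: "?E \<in> sets ?N" by (intro sets_PiM_I_finite) (use A in auto)
  have Bm: "(\<lambda>\<omega>. \<lambda>i\<in>{..n}. B (p i) \<omega>) \<in> measurable M ?N"
    using B p(1) unfolding wiener_process_def by (intro measurable_restrict) auto
  have "path_of B \<omega> \<in> ?X \<longleftrightarrow> (\<forall>t\<in>J. B t \<omega> \<in> A t)" for \<omega>
    using J by (auto simp: prod_emb_def path_of_def PiE_iff subset_iff)
  moreover have "(\<lambda>i\<in>{..n}. B (p i) \<omega>) \<in> ?E \<longleftrightarrow> (\<forall>t\<in>J. B t \<omega> \<in> A t)" for \<omega>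
    using p(2) by (force simp: PiE_iff)
  ultimately have "path_of B -` ?X \<inter> space M = (\<lambda>\<omega>. \<lambda>i\<in>{..n}. B (p i) \<omega>) -` ?E \<inter> space M"
    by auto
  then show ?thesis
    by (simp add: emeasure_distr[OF measurable_path_of[OF B] X] emeasure_distr[OF Bm E])
qed

text \<open>Cylinders generate the product \<open>\<sigma>\<close>-algebra and are stable under intersection, so the
  finite-dimensional laws determine the law. This allows results on one Wiener process to be
  transferred to another one that lives on a different probability space.\<close>

lemma wiener_process_law_unique:
  assumes W: "wiener_process M B" and W': "wiener_process M' B'"
  shows "distr M path_space (path_of B) = distr M' path_space (path_of B')"
proof (rule measure_eqI_PiM_infinite)
  interpret M: prob_space M using W by (simp add: wiener_process_def)
  interpret D: prob_space "distr M path_space (path_of B)"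
    by (rule M.prob_space_distr[OF measurable_path_of[OF W]])
  show "finite_measure (distr M path_space (path_of B))" by unfold_locales
  fix A :: "real \<Rightarrow> real set" and J :: "real set"
  assume J: "finite J" "J \<subseteq> {0..}" and A: "\<And>i. i \<in> J \<Longrightarrow> A i \<in> sets borel"
  obtain p :: "nat \<Rightarrow> real" and n where p: "p 0 = 0" "strict_mono_on {..n} p" "n > 0" "J \<subseteq> p ` {..n}"
    using finite_set_enumeration_from_0[OF J] by blast
  have p0: "p i \<ge> 0" if "i \<le> n" for i
    using strict_mono_onD[OF p(2), of 0 i] p(1) that by (cases "i = 0") auto
  show "emeasure (distr M path_space (path_of B)) (prod_emb {0..} (\<lambda>_. borel) J (Pi\<^sub>E J A)) =
      emeasure (distr M' path_space (path_of B')) (prod_emb {0..} (\<lambda>_. borel) J (Pi\<^sub>E J A))"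
    using emeasure_path_of_cylinder[OF W p0 p(4) J A] emeasure_path_of_cylinder[OF W' p0 p(4) J A]
    by (simp add: wiener_process_finite_dim[OF W p(1-3)] wiener_process_finite_dim[OF W' p(1-3)])
qed simp_all

section \<open>Discounted occupation times of a Wiener process\<close>

lemma nn_integral_exp_neg: "(\<integral>\<^sup>+s\<in>{0..}. ennreal (exp (- s)) \<partial>lborel) = 1"
  using nn_intergal_power_times_exp_Ici[of 0] by simp

text \<open>The integral equals \<open>\<Gamma>(1/2) / sqrt (2 * pi) = 1 / sqrt 2\<close>.\<close>

lemma nn_integral_exp_neg_over_sqrt:
  "(\<integral>\<^sup>+s\<in>{0..}. ennreal (exp (- s) / sqrt (2 * pi * s)) \<partial>lborel) \<le> 1"
proof -
  have "(\<integral>\<^sup>+s\<in>{0..}. ennreal (exp (- s) / sqrt (2 * pi * s)) \<partial>lborel) =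
      (\<integral>\<^sup>+s. ennreal (1 / sqrt (2 * pi)) * ennreal (indicator {0..} s * s powr (1/2 - 1) / exp s) \<partial>lborel)"
  proof (rule nn_integral_cong_AE)
    have "AE s in lborel. s \<noteq> (0::real)" by (rule AE_lborel_singleton)
    then show "AE s in lborel. ennreal (exp (- s) / sqrt (2 * pi * s)) * indicator {0..} s =
        ennreal (1 / sqrt (2 * pi)) * ennreal (indicator {0..} s * s powr (1/2 - 1) / exp s)"
    proof eventually_elim
      case (elim s)
      show ?case
      proof (cases "s > 0")
        case True
        have "s powr (1/2 - 1) = 1 / sqrt s"
          using True by (simp add: powr_minus powr_half_sqrt inverse_eq_divide)
        then show ?thesis
          using True by (simp add: ennreal_mult[symmetric] real_sqrt_mult exp_minus field_simps)
      qed (use elim in auto)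
    qed
  qed
  also have "\<dots> = ennreal (1 / sqrt (2 * pi)) * ennreal (Gamma (1/2))"
    by (subst nn_integral_cmult) (auto simp: Gamma_conv_nn_integral_real)
  also have "\<dots> = ennreal (1 / sqrt 2)"
    by (simp add: Gamma_one_half_real ennreal_mult[symmetric] real_sqrt_mult)
  also have "\<dots> \<le> ennreal 1"
    by (intro ennreal_leI) (simp add: field_simps)
  finally show ?thesis by simp
qed

text \<open>The density of \<open>B s\<close> is at most \<open>1 / sqrt (2 * pi * s)\<close>; the factor \<open>1 / a\<close> is the Jacobian of
  the dilation.\<close>

lemma wiener_process_nn_integral_le:
  assumes W: "wiener_process M B" and s: "s > 0" and a: "a > 0" and h [measurable]: "h \<in> borel_measurable borel"
  shows "(\<integral>\<^sup>+\<omega>. h (a * B s \<omega>) \<partial>M) \<le> ennreal (1 / (a * sqrt (2 * pi * s))) * (\<integral>\<^sup>+x. h x \<partial>lborel)"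
proof -
  have "distributed M lborel (\<lambda>\<omega>. B s \<omega> - B 0 \<omega>) (normal_density 0 (sqrt (s - 0)))"
    using W s unfolding wiener_process_def by blast
  then have D: "distributed M lborel (\<lambda>\<omega>. B s \<omega> - B 0 \<omega>) (normal_density 0 (sqrt s))"
    by simp
  have "AE \<omega> in M. B 0 \<omega> = 0" using W by (simp add: wiener_process_def)
  then have "AE \<omega> in M. h (a * B s \<omega>) = h (a * (B s \<omega> - B 0 \<omega>))"
    by eventually_elim simp
  then have "(\<integral>\<^sup>+\<omega>. h (a * B s \<omega>) \<partial>M) = (\<integral>\<^sup>+\<omega>. h (a * (B s \<omega> - B 0 \<omega>)) \<partial>M)"
    by (rule nn_integral_cong_AE)
  also have "\<dots> = (\<integral>\<^sup>+x. ennreal (normal_density 0 (sqrt s) x) * h (a * x) \<partial>lborel)"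
    by (rule distributed_nn_integral[OF D, symmetric]) measurable
  also have "\<dots> \<le> (\<integral>\<^sup>+x. ennreal (1 / sqrt (2 * pi * s)) * h (a * x) \<partial>lborel)"
    by (intro nn_integral_mono mult_right_mono ennreal_leI)
      (use s in \<open>auto simp: normal_density_def intro!: divide_right_mono\<close>)
  also have "\<dots> = ennreal (1 / sqrt (2 * pi * s)) * (\<integral>\<^sup>+x. h (a * x) \<partial>lborel)"
    by (rule nn_integral_cmult) measurable
  also have "(\<integral>\<^sup>+x. h (a * x) \<partial>lborel) = ennreal (1 / a) * (\<integral>\<^sup>+x. h x \<partial>lborel)"
  proof -
    have "ennreal (1 / a) * (\<integral>\<^sup>+x. h x \<partial>lborel) =
        (ennreal (1 / a) * ennreal a) * (\<integral>\<^sup>+x. h (a * x) \<partial>lborel)"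
      using nn_integral_real_affine[OF h, of a 0] a by (simp add: mult.assoc)
    also have "ennreal (1 / a) * ennreal a = 1"
      using a by (subst ennreal_mult[symmetric]) auto
    finally show ?thesis by simp
  qed
  also have "ennreal (1 / sqrt (2 * pi * s)) * (ennreal (1 / a) * (\<integral>\<^sup>+x. h x \<partial>lborel)) =
      ennreal (1 / sqrt (2 * pi * s) * (1 / a)) * (\<integral>\<^sup>+x. h x \<partial>lborel)"
    using a s by (subst ennreal_mult) (auto simp: mult.assoc)
  finally show ?thesis
    by (simp add: mult.commute)
qed

text \<open>Tonelli's theorem. It needs joint measurability in time and outcome, which the coordinate process
  evaluated along the path of \<open>B\<close> has.\<close>

lemma wiener_process_nn_integral_exp_neg_swap:
  assumes W: "wiener_process M B" and h [measurable]: "h \<in> borel_measurable borel"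
  shows "(\<integral>\<^sup>+\<omega>. (\<integral>\<^sup>+s\<in>{0..}. ennreal (exp (- s)) * h (B s \<omega>) \<partial>lborel) \<partial>M) =
    (\<integral>\<^sup>+s\<in>{0..}. ennreal (exp (- s)) * (\<integral>\<^sup>+\<omega>. h (B s \<omega>) \<partial>M) \<partial>lborel)"
proof -
  interpret prob_space M using W by (simp add: wiener_process_def)
  interpret pair_sigma_finite lborel M ..
  note [measurable] = measurable_path_of[OF W]
  let ?V = "\<lambda>s \<omega>. path_ext (path_of B \<omega>) s"
  note V = wiener_process_coordinate[OF W]
  have "(\<integral>\<^sup>+\<omega>. (\<integral>\<^sup>+s\<in>{0..}. ennreal (exp (- s)) * h (B s \<omega>) \<partial>lborel) \<partial>M) =
      (\<integral>\<^sup>+\<omega>. (\<integral>\<^sup>+s\<in>{0..}. ennreal (exp (- s)) * h (?V s \<omega>) \<partial>lborel) \<partial>M)"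
  proof (rule nn_integral_cong_AE)
    show "AE \<omega> in M. (\<integral>\<^sup>+s\<in>{0..}. ennreal (exp (- s)) * h (B s \<omega>) \<partial>lborel) =
       (\<integral>\<^sup>+s\<in>{0..}. ennreal (exp (- s)) * h (?V s \<omega>) \<partial>lborel)"
      using V by eventually_elim (auto intro!: nn_integral_cong simp: indicator_def)
  qed
  also have "\<dots> = (\<integral>\<^sup>+s. (\<integral>\<^sup>+\<omega>. ennreal (exp (- s)) * h (?V s \<omega>) * indicator {0..} s \<partial>M) \<partial>lborel)"
    by (rule Fubini') measurable
  also have "\<dots> = (\<integral>\<^sup>+s\<in>{0..}. ennreal (exp (- s)) * (\<integral>\<^sup>+\<omega>. h (B s \<omega>) \<partial>M) \<partial>lborel)"
  proof (rule nn_integral_cong)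
    fix s :: real
    show "(\<integral>\<^sup>+\<omega>. ennreal (exp (- s)) * h (?V s \<omega>) * indicator {0..} s \<partial>M) =
       ennreal (exp (- s)) * (\<integral>\<^sup>+\<omega>. h (B s \<omega>) \<partial>M) * indicator {0..} s"
    proof (cases "s \<ge> 0")
      case True
      have "(\<integral>\<^sup>+\<omega>. ennreal (exp (- s)) * h (?V s \<omega>) \<partial>M) = ennreal (exp (- s)) * (\<integral>\<^sup>+\<omega>. h (?V s \<omega>) \<partial>M)"
        by (rule nn_integral_cmult) measurable
      also have "(\<integral>\<^sup>+\<omega>. h (?V s \<omega>) \<partial>M) = (\<integral>\<^sup>+\<omega>. h (B s \<omega>) \<partial>M)"
        using V True by (intro nn_integral_cong_AE) (auto elim!: AE_mp)
      finally show ?thesis using True by simp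
    qed simp
  qed
  finally show ?thesis .
qed

text \<open>A rough substitute for the occupation density formula. Since the bound on the density of \<open>B s\<close> is
  integrable against \<open>exp (- s)\<close>, an integrable function contributes at most its integral, and
  evaluating it at \<open>a * B s\<close> with large \<open>a\<close> makes this contribution small.\<close>

lemma wiener_process_discounted_occupation_le:
  assumes W: "wiener_process M B" and a: "a > 0"
    and h [measurable]: "h \<in> borel_measurable borel" and g [measurable]: "g \<in> borel_measurable borel"
    and hg: "\<And>x. h x \<le> e + g x"
  shows "(\<integral>\<^sup>+\<omega>. (\<integral>\<^sup>+s\<in>{0..}. ennreal (exp (- s)) * h (a * B s \<omega>) \<partial>lborel) \<partial>M) \<le>
    e + ennreal (1 / a) * (\<integral>\<^sup>+x. g x \<partial>lborel)"
proof -
  interpret prob_space M using W by (simp add: wiener_process_def)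
  have Bm: "B s \<in> borel_measurable M" if "s \<ge> 0" for s
    using W that by (simp add: wiener_process_def)
  let ?G = "ennreal (1 / a) * (\<integral>\<^sup>+x. g x \<partial>lborel)"
  have "(\<integral>\<^sup>+\<omega>. (\<integral>\<^sup>+s\<in>{0..}. ennreal (exp (- s)) * h (a * B s \<omega>) \<partial>lborel) \<partial>M) =
      (\<integral>\<^sup>+s\<in>{0..}. ennreal (exp (- s)) * (\<integral>\<^sup>+\<omega>. h (a * B s \<omega>) \<partial>M) \<partial>lborel)"
    by (rule wiener_process_nn_integral_exp_neg_swap[OF W]) measurable
  also have "\<dots> \<le> (\<integral>\<^sup>+s. (ennreal (exp (- s)) * indicator {0..} s) * e +
      (ennreal (exp (- s) / sqrt (2 * pi * s)) * indicator {0..} s) * ?G \<partial>lborel)"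
  proof (rule nn_integral_mono_AE)
    have "AE s in lborel. s \<noteq> (0::real)" by (rule AE_lborel_singleton)
    then show "AE s in lborel. ennreal (exp (- s)) * (\<integral>\<^sup>+\<omega>. h (a * B s \<omega>) \<partial>M) * indicator {0..} s
        \<le> (ennreal (exp (- s)) * indicator {0..} s) * e +
          (ennreal (exp (- s) / sqrt (2 * pi * s)) * indicator {0..} s) * ?G"
    proof eventually_elim
      case (elim s)
      show ?case
      proof (cases "s > 0")
        case True
        have [measurable]: "B s \<in> borel_measurable M" using Bm True by simp
        have "(\<integral>\<^sup>+\<omega>. h (a * B s \<omega>) \<partial>M) \<le> (\<integral>\<^sup>+\<omega>. e + g (a * B s \<omega>) \<partial>M)"
          by (intro nn_integral_mono hg)
        also have "\<dots> = e + (\<integral>\<^sup>+\<omega>. g (a * B s \<omega>) \<partial>M)"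
          by (subst nn_integral_add) (auto simp: emeasure_space_1)
        also have "\<dots> \<le> e + ennreal (1 / (a * sqrt (2 * pi * s))) * (\<integral>\<^sup>+x. g x \<partial>lborel)"
          by (intro add_left_mono wiener_process_nn_integral_le W True a g)
        also have "ennreal (1 / (a * sqrt (2 * pi * s))) * (\<integral>\<^sup>+x. g x \<partial>lborel) =
            ennreal (1 / sqrt (2 * pi * s)) * ?G"
        proof -
          have "ennreal (1 / (a * sqrt (2 * pi * s))) = ennreal (1 / sqrt (2 * pi * s)) * ennreal (1 / a)"
            using a True by (subst ennreal_mult[symmetric]) (auto simp: mult.commute)
          then show ?thesis by (simp add: mult.assoc)
        qed
        finally have "ennreal (exp (- s)) * (\<integral>\<^sup>+\<omega>. h (a * B s \<omega>) \<partial>M) \<le>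
            ennreal (exp (- s)) * (e + ennreal (1 / sqrt (2 * pi * s)) * ?G)"
          by (intro mult_left_mono) auto
        also have "\<dots> = ennreal (exp (- s)) * e + ennreal (exp (- s) / sqrt (2 * pi * s)) * ?G"
          using True by (simp add: distrib_left mult.assoc[symmetric] ennreal_mult[symmetric])
        finally show ?thesis using True by simp
      qed (use elim in auto)
    qed
  qed
  also have "\<dots> = (\<integral>\<^sup>+s. (ennreal (exp (- s)) * indicator {0..} s) * e \<partial>lborel) +
      (\<integral>\<^sup>+s. (ennreal (exp (- s) / sqrt (2 * pi * s)) * indicator {0..} s) * ?G \<partial>lborel)"
    by (rule nn_integral_add) measurable
  also have "\<dots> = 1 * e + (\<integral>\<^sup>+s\<in>{0..}. ennreal (exp (- s) / sqrt (2 * pi * s)) \<partial>lborel) * ?G"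
    by (subst (1 2) nn_integral_multc) (simp_all add: nn_integral_exp_neg)
  also have "\<dots> \<le> 1 * e + 1 * ?G"
    by (intro add_left_mono mult_right_mono nn_integral_exp_neg_over_sqrt) auto
  finally show ?thesis by simp
qed

definition admissible_rate :: "(real \<Rightarrow> real) \<Rightarrow> real \<Rightarrow> real \<Rightarrow> bool" where
  "admissible_rate lam ap am \<longleftrightarrow>
     lam \<in> borel_measurable borel \<and> (\<forall>x. 0 < lam x) \<and>
     (\<forall>K. compact K \<longrightarrow> set_integrable lborel K (\<lambda>x. 1 / lam x)) \<and>
     0 < ap \<and> 0 < am \<and> (lam \<longlongrightarrow> ap) at_top \<and> (lam \<longlongrightarrow> am) at_bot"

text \<open>Away from \<open>0\<close>, the limit of \<open>\<lambda>x. lam (c * x)\<close> as \<open>c\<close> tends to infinity. Its reciprocal is \<^const>\<open>nu\<close> except at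
  \<open>0\<close>, where this function, unlike \<^const>\<open>nu\<close>, corresponds to a positive speed of the clock.\<close>

definition step_rate :: "real \<Rightarrow> real \<Rightarrow> real \<Rightarrow> real" where
  "step_rate ap am x = (if 0 < x then ap else am)"

lemma measurable_step_rate [measurable]: "step_rate ap am \<in> borel_measurable borel"
  unfolding step_rate_def by measurable

lemma step_rate_mult: "c > 0 \<Longrightarrow> step_rate ap am (c * x) = step_rate ap am x"
  by (simp add: step_rate_def zero_less_mult_iff)

text \<open>The discount \<open>exp (- s)\<close> makes this quantity control the distance between the clocks of \<open>lam\<close> and
  \<open>lam'\<close> on all bounded time intervals at once, while its expectation stays finite.\<close>

definition clock_defect ::
  "(real \<Rightarrow> real) \<Rightarrow> (real \<Rightarrow> real) \<Rightarrow> (real \<Rightarrow> 'a \<Rightarrow> real) \<Rightarrow> 'a \<Rightarrow> ennreal" where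
  "clock_defect lam lam' B \<omega> =
     (\<integral>\<^sup>+s\<in>{0..}. ennreal (exp (- s)) * ennreal \<bar>inverse (lam (B s \<omega>)) - inverse (lam' (B s \<omega>))\<bar> \<partial>lborel)"

text \<open>Outside a compact interval the two reciprocals differ by at most \<open>e\<close>; on the interval \<open>g\<close> is the
  sum of an integrable function and a constant.\<close>

lemma admissible_rate_defect_decomposition:
  assumes lam: "admissible_rate lam ap am" and e: "e > 0"
  obtains g :: "real \<Rightarrow> ennreal" where "g \<in> borel_measurable borel" "(\<integral>\<^sup>+x. g x \<partial>lborel) < \<infinity>"
    "\<And>x. ennreal \<bar>inverse (lam x) - inverse (step_rate ap am x)\<bar> \<le> ennreal e + g x"
proof -
  have [measurable]: "lam \<in> borel_measurable borel" and pos: "lam x > 0" "ap > 0" "am > 0"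
    and int: "set_integrable lborel {-K..K} (\<lambda>x. 1 / lam x)" for x K
    using lam by (auto simp: admissible_rate_def)
  have p: "((\<lambda>x. inverse (lam x)) \<longlongrightarrow> inverse ap) at_top"
    and m: "((\<lambda>x. inverse (lam x)) \<longlongrightarrow> inverse am) at_bot"
    using lam by (auto simp: admissible_rate_def intro!: tendsto_inverse)
  obtain K1 where K1: "\<And>x. x \<ge> K1 \<Longrightarrow> \<bar>inverse (lam x) - inverse ap\<bar> < e"
    using tendstoD[OF p e] by (auto simp: eventually_at_top_linorder dist_real_def)
  obtain K2 where K2: "\<And>x. x \<le> K2 \<Longrightarrow> \<bar>inverse (lam x) - inverse am\<bar> < e"
    using tendstoD[OF m e] by (auto simp: eventually_at_bot_linorder dist_real_def)
  define K where "K = max 1 (max K1 (- K2))"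
  define C where "C = inverse ap + inverse am"
  define g where "g x = ennreal (1 / lam x + C) * indicator {-K..K} x" for x
  have "(\<integral>\<^sup>+x. g x \<partial>lborel) =
      (\<integral>\<^sup>+x. ennreal (indicator {-K..K} x *\<^sub>R (1 / lam x)) + ennreal C * indicator {-K..K} x \<partial>lborel)"
    using pos by (intro nn_integral_cong)
      (auto simp: g_def C_def indicator_def less_imp_le ennreal_plus)
  also have "\<dots> = (\<integral>\<^sup>+x. ennreal (indicator {-K..K} x *\<^sub>R (1 / lam x)) \<partial>lborel) +
      (\<integral>\<^sup>+x. ennreal C * indicator {-K..K} x \<partial>lborel)"
    by (rule nn_integral_add) measurable
  also have "\<dots> < \<infinity>"
  proof -
    have "integrable lborel (\<lambda>x. indicator {-K..K} x *\<^sub>R (1 / lam x))"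
      using int[of K] by (simp add: set_integrable_def)
    then have "(\<integral>\<^sup>+x. ennreal (norm (indicator {-K..K} x *\<^sub>R (1 / lam x))) \<partial>lborel) < \<infinity>"
      by (simp only: integrable_iff_bounded)
    moreover have "norm (indicator {-K..K} x *\<^sub>R (1 / lam x)) = indicator {-K..K} x *\<^sub>R (1 / lam x)" for x
      using pos(1)[of x] by (simp add: indicator_def less_imp_le)
    ultimately have "(\<integral>\<^sup>+x. ennreal (indicator {-K..K} x *\<^sub>R (1 / lam x)) \<partial>lborel) < \<infinity>"
      by (simp only:)
    then show ?thesis
      by (simp add: nn_integral_cmult ennreal_mult_less_top emeasure_lborel_Icc_eq)
  qed
  finally have fin: "(\<integral>\<^sup>+x. g x \<partial>lborel) < \<infinity>" .
  show thesis
  proof (rule that[OF _ fin])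
    show "g \<in> borel_measurable borel" unfolding g_def by measurable
    fix x
    show "ennreal \<bar>inverse (lam x) - inverse (step_rate ap am x)\<bar> \<le> ennreal e + g x"
    proof (cases "x \<in> {-K..K}")
      case True
      have "\<bar>inverse (lam x) - inverse (step_rate ap am x)\<bar> \<le> 1 / lam x + C"
        using pos(1)[of x] pos(2,3)
        by (auto simp: step_rate_def C_def inverse_eq_divide abs_le_iff add_nonneg_nonneg)
      then have "ennreal \<bar>inverse (lam x) - inverse (step_rate ap am x)\<bar> \<le> g x"
        using True by (simp add: g_def ennreal_leI)
      then show ?thesis by (simp add: add_increasing)
    next
      case False
      then consider "x > K" | "x < -K" by force
      then have "\<bar>inverse (lam x) - inverse (step_rate ap am x)\<bar> \<le> e"
      proof cases
        case 1
        then show ?thesis using K1[of x] by (auto simp: K_def step_rate_def)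
      next
        case 2
        then have "x \<le> K2" "x \<le> 0" unfolding K_def by linarith+
        then show ?thesis using K2[of x] by (simp add: step_rate_def)
      qed
      then show ?thesis by (simp add: add_increasing2 ennreal_leI)
    qed
  qed
qed

text \<open>The step rate is invariant under dilation, so the integrand of the defect is the function
  \<open>\<bar>1 / lam - 1 / step_rate\<bar>\<close> evaluated at \<open>c * B s\<close>.\<close>

lemma nn_integral_clock_defect_le:
  assumes W: "wiener_process M B" and c: "c > 0" and lam: "lam \<in> borel_measurable borel"
    and g: "g \<in> borel_measurable borel"
    and le: "\<And>x. ennreal \<bar>inverse (lam x) - inverse (step_rate ap am x)\<bar> \<le> e + g x"
  shows "(\<integral>\<^sup>+\<omega>. clock_defect (\<lambda>x. lam (c * x)) (step_rate ap am) B \<omega> \<partial>M) \<le>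
    e + ennreal (1 / c) * (\<integral>\<^sup>+x. g x \<partial>lborel)"
proof -
  note [measurable] = lam
  have "clock_defect (\<lambda>x. lam (c * x)) (step_rate ap am) B \<omega> =
     (\<integral>\<^sup>+s\<in>{0..}. ennreal (exp (- s)) *
       ennreal \<bar>inverse (lam (c * B s \<omega>)) - inverse (step_rate ap am (c * B s \<omega>))\<bar> \<partial>lborel)" for \<omega>
    by (simp add: clock_defect_def step_rate_mult[OF c])
  then show ?thesis
    by (simp only:)
      (rule wiener_process_discounted_occupation_le[OF W c _ g le], measurable)
qed

lemma clock_defect_cong:
  "(\<And>s. s \<ge> 0 \<Longrightarrow> B s \<omega> = C s \<omega>') \<Longrightarrow> clock_defect lam lam' B \<omega> = clock_defect lam lam' C \<omega>'"
  unfolding clock_defect_def by (intro nn_integral_cong) (simp add: indicator_def)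

lemma measurable_clock_defect:
  assumes [measurable]: "lam \<in> borel_measurable borel" "lam' \<in> borel_measurable borel"
  shows "clock_defect lam lam' coordinate_process \<in> borel_measurable path_space"
  unfolding clock_defect_def by measurable

text \<open>The expected defect is at most \<open>e + H / c n\<close> for each \<open>e > 0\<close> with some \<open>H\<close> that depends on \<open>e\<close>
  only, so it tends to \<open>0\<close>. The bound does not depend on the Wiener process, which may therefore
  vary with \<open>n\<close>: a fixed process gives the limit theorem, and the Brownian rescalings of one process
  give the divergence of its clock.\<close>

lemma clock_defect_subseq_AE_tendsto_0:
  assumes M: "prob_space M" and V: "\<And>n. wiener_process M (V n)"
    and lam: "admissible_rate lam ap am"
    and c: "\<And>n. c n > 0" "filterlim c at_top sequentially"
  shows "\<exists>r. strict_mono r \<and> (AE \<omega> in M.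
    (\<lambda>n. clock_defect (\<lambda>x. lam (c (r n) * x)) (step_rate ap am) (V (r n)) \<omega>) \<longlonglongrightarrow> 0)"
proof -
  interpret prob_space M by fact
  have lam_m [measurable]: "lam \<in> borel_measurable borel" using lam by (simp add: admissible_rate_def)
  let ?D = "\<lambda>n. clock_defect (\<lambda>x. lam (c n * x)) (step_rate ap am)"
  define u where "u n \<omega> = ?D n coordinate_process (path_of (V n) \<omega>)" for n \<omega>
  have u_m [measurable]: "u n \<in> borel_measurable M" for n
    unfolding u_def by (rule measurable_compose[OF measurable_path_of[OF V] measurable_clock_defect]) auto
  have u_eq: "AE \<omega> in M. \<forall>n. ?D n (V n) \<omega> = u n \<omega>"
    unfolding AE_all_countable u_def
  proof
    fix n
    show "AE \<omega> in M. ?D n (V n) \<omega> = ?D n coordinate_process (path_of (V n) \<omega>)"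
      using wiener_process_coordinate[OF V] by eventually_elim (auto intro!: clock_defect_cong)
  qed
  have u_le: "(\<integral>\<^sup>+\<omega>. u n \<omega> \<partial>M) \<le> e + ennreal (1 / c n) * (\<integral>\<^sup>+x. g x \<partial>lborel)"
    if "g \<in> borel_measurable borel"
      "\<And>x. ennreal \<bar>inverse (lam x) - inverse (step_rate ap am x)\<bar> \<le> e + g x" for n e g
  proof -
    have "(\<integral>\<^sup>+\<omega>. u n \<omega> \<partial>M) = (\<integral>\<^sup>+\<omega>. ?D n (V n) \<omega> \<partial>M)"
      using u_eq by (intro nn_integral_cong_AE) (auto elim: AE_mp)
    then show ?thesis
      using nn_integral_clock_defect_le[OF V c(1) lam_m that] by simp
  qed
  have u_fin: "(\<integral>\<^sup>+\<omega>. u n \<omega> \<partial>M) < \<infinity>" for n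
  proof -
    obtain g :: "real \<Rightarrow> ennreal" where g: "g \<in> borel_measurable borel" "(\<integral>\<^sup>+x. g x \<partial>lborel) < \<infinity>"
      "\<And>x. ennreal \<bar>inverse (lam x) - inverse (step_rate ap am x)\<bar> \<le> ennreal 1 + g x"
      using admissible_rate_defect_decomposition[OF lam, of 1] by (metis zero_less_one)
    have "ennreal 1 + ennreal (1 / c n) * (\<integral>\<^sup>+x. g x \<partial>lborel) < \<infinity>"
      using g(2) by (simp add: ennreal_mult_less_top)
    with u_le[OF g(1,3), of n] show ?thesis by (rule le_less_trans)
  qed
  have lim: "(\<lambda>n. \<integral>\<^sup>+\<omega>. u n \<omega> \<partial>M) \<longlonglongrightarrow> 0"
  proof (rule tendsto_zero_ennreal)
    fix e :: real assume e: "0 < e"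
    obtain g :: "real \<Rightarrow> ennreal" where g: "g \<in> borel_measurable borel" "(\<integral>\<^sup>+x. g x \<partial>lborel) < \<infinity>"
      "\<And>x. ennreal \<bar>inverse (lam x) - inverse (step_rate ap am x)\<bar> \<le> ennreal (e / 2) + g x"
      using admissible_rate_defect_decomposition[OF lam, of "e / 2"] e by (metis half_gt_zero)
    define H where "H = enn2real (\<integral>\<^sup>+x. g x \<partial>lborel)"
    have H: "(\<integral>\<^sup>+x. g x \<partial>lborel) = ennreal H" "H \<ge> 0" using g(2) by (auto simp: H_def)
    have "\<forall>\<^sub>F n in sequentially. c n > 2 * H / e"
      using c(2) by (auto simp: filterlim_at_top_dense)
    then show "\<forall>\<^sub>F n in sequentially. (\<integral>\<^sup>+\<omega>. u n \<omega> \<partial>M) < ennreal e"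
    proof eventually_elim
      case (elim n)
      have "(\<integral>\<^sup>+\<omega>. u n \<omega> \<partial>M) \<le> ennreal (e / 2) + ennreal (1 / c n) * ennreal H"
        using u_le[OF g(1,3), of n] by (simp add: H)
      also have "\<dots> = ennreal (e / 2 + H / c n)"
        using e H(2) c(1)[of n] by (simp add: ennreal_mult[symmetric] ennreal_plus[symmetric] del: ennreal_plus)
      also have "\<dots> < ennreal e"
      proof (rule ennreal_lessI)
        have "2 * H < e * c n" using elim e by (simp add: field_simps)
        then have "H / c n < e / 2" using c(1)[of n] by (simp add: pos_divide_less_eq)
        then show "e / 2 + H / c n < e" by linarith
      qed (use e in simp)
      finally show ?case .
    qed
  qed
  have u_top: "AE \<omega> in M. \<forall>n. u n \<omega> \<noteq> \<infinity>"
    unfolding AE_all_countable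
    by (intro allI nn_integral_noteq_infinite u_m) (use u_fin in \<open>auto simp: less_top\<close>)
  let ?u = "\<lambda>n \<omega>. enn2real (u n \<omega>)"
  have nn: "(\<integral>\<^sup>+\<omega>. ennreal (norm (?u n \<omega>)) \<partial>M) = (\<integral>\<^sup>+\<omega>. u n \<omega> \<partial>M)" for n
    using u_top by (intro nn_integral_cong_AE) (auto elim!: AE_mp simp: less_top)
  have int: "integrable M (?u n)" for n
    unfolding integrable_iff_bounded using u_fin[of n] nn[of n] by auto
  have "(\<lambda>n. \<integral>\<omega>. norm (?u n \<omega>) \<partial>M) \<longlonglongrightarrow> 0"
  proof -
    have "(\<integral>\<omega>. norm (?u n \<omega>) \<partial>M) = enn2real (\<integral>\<^sup>+\<omega>. u n \<omega> \<partial>M)" for n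
      using nn[of n] by (subst integral_eq_nn_integral) auto
    then show ?thesis
      using tendsto_enn2real[where u="\<lambda>n. \<integral>\<^sup>+\<omega>. u n \<omega> \<partial>M" and l=0 and F=sequentially] lim by simp
  qed
  from tendsto_L1_AE_subseq[OF int this] obtain r :: "nat \<Rightarrow> nat" where
    r: "strict_mono r" "AE \<omega> in M. (\<lambda>n. ?u (r n) \<omega>) \<longlonglongrightarrow> 0"
    by blast
  from r(2) u_top u_eq have "AE \<omega> in M. (\<lambda>n. ?D (r n) (V (r n)) \<omega>) \<longlonglongrightarrow> 0"
  proof eventually_elim
    case (elim \<omega>)
    have "(\<lambda>n. ennreal (?u (r n) \<omega>)) \<longlonglongrightarrow> ennreal 0" using elim(1) by (intro tendsto_ennrealI)
    moreover have "ennreal (?u (r n) \<omega>) = ?D (r n) (V (r n)) \<omega>" for n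
      using elim(2,3) by (simp add: less_top)
    ultimately show ?case by simp
  qed
  with r(1) show ?thesis by blast
qed

lemma clock_defect_finite_AE:
  assumes W: "wiener_process M B" and lam: "admissible_rate lam ap am"
  shows "AE \<omega> in M. clock_defect lam (step_rate ap am) B \<omega> < \<infinity>"
proof -
  have M: "prob_space M" using W by (simp add: wiener_process_def)
  have lam_m: "lam \<in> borel_measurable borel" using lam by (simp add: admissible_rate_def)
  let ?u = "\<lambda>\<omega>. clock_defect lam (step_rate ap am) coordinate_process (path_of B \<omega>)"
  have u_m: "?u \<in> borel_measurable M"
    by (rule measurable_compose[OF measurable_path_of[OF W] measurable_clock_defect[OF lam_m]]) auto
  have eq: "AE \<omega> in M. clock_defect lam (step_rate ap am) B \<omega> = ?u \<omega>"
    using wiener_process_coordinate[OF W] by eventually_elim (auto intro!: clock_defect_cong)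
  obtain g :: "real \<Rightarrow> ennreal" where g: "g \<in> borel_measurable borel" "(\<integral>\<^sup>+x. g x \<partial>lborel) < \<infinity>"
    "\<And>x. ennreal \<bar>inverse (lam x) - inverse (step_rate ap am x)\<bar> \<le> ennreal 1 + g x"
    using admissible_rate_defect_decomposition[OF lam, of 1] by (metis zero_less_one)
  have "(\<integral>\<^sup>+\<omega>. ?u \<omega> \<partial>M) = (\<integral>\<^sup>+\<omega>. clock_defect lam (step_rate ap am) B \<omega> \<partial>M)"
    using eq by (intro nn_integral_cong_AE) (auto elim: AE_mp)
  also have "\<dots> \<le> ennreal 1 + ennreal (1 / 1) * (\<integral>\<^sup>+x. g x \<partial>lborel)"
    using nn_integral_clock_defect_le[OF W _ lam_m g(1,3), of 1] by simp
  also have "\<dots> < \<infinity>" using g(2) by simp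
  finally have "AE \<omega> in M. ?u \<omega> \<noteq> \<infinity>"
    by (intro nn_integral_noteq_infinite u_m) auto
  with eq show ?thesis by eventually_elim (simp add: less_top)
qed

text \<open>The occupation bound for the indicator of \<open>{0}\<close>, whose integral is zero.\<close>

lemma wiener_process_zero_set_null:
  assumes W: "wiener_process M B"
  shows "AE \<omega> in M. AE s in lborel. s \<ge> 0 \<longrightarrow> B s \<omega> \<noteq> 0"
proof -
  note [measurable] = measurable_path_of[OF W]
  let ?h = "indicator {0} :: real \<Rightarrow> ennreal"
  let ?u = "\<lambda>\<omega>. \<integral>\<^sup>+s\<in>{0..}. ennreal (exp (- s)) * ?h (1 * B s \<omega>) \<partial>lborel"
  let ?v = "\<lambda>\<omega>. \<integral>\<^sup>+s\<in>{0..}. ennreal (exp (- s)) * ?h (path_ext (path_of B \<omega>) s) \<partial>lborel"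
  interpret prob_space M using W by (simp add: wiener_process_def)
  have eq: "AE \<omega> in M. ?u \<omega> = ?v \<omega>"
    using wiener_process_coordinate[OF W]
    by eventually_elim (auto intro!: nn_integral_cong simp: indicator_def)
  have "(\<integral>\<^sup>+\<omega>. ?u \<omega> \<partial>M) \<le> 0 + ennreal (1 / 1) * (\<integral>\<^sup>+x. ?h x \<partial>lborel)"
    by (rule wiener_process_discounted_occupation_le[OF W]) auto
  then have "(\<integral>\<^sup>+\<omega>. ?v \<omega> \<partial>M) = 0"
    using nn_integral_cong_AE[OF eq] by simp
  then have "AE \<omega> in M. ?v \<omega> = 0"
    by (subst (asm) nn_integral_0_iff_AE) auto
  with wiener_process_coordinate[OF W] AE_space show ?thesis
  proof eventually_elim
    case (elim \<omega>)
    have [measurable]: "(\<lambda>s. path_ext (path_of B \<omega>) s) \<in> borel_measurable lborel"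
      using measurable_space[OF measurable_path_of[OF W] elim(2)] by measurable
    have "AE s in lborel. ennreal (exp (- s)) * ?h (path_ext (path_of B \<omega>) s) * indicator {0..} s = 0"
      using elim(3) by (subst (asm) nn_integral_0_iff_AE) auto
    then show ?case
      by eventually_elim (use elim(1) in \<open>auto simp: indicator_def split: if_splits\<close>)
  qed
qed

section \<open>Inverses of clocks\<close>

text \<open>The increasing homeomorphisms of the half-line \<open>{0..}\<close>.\<close>

definition regular_clock :: "(real \<Rightarrow> real) \<Rightarrow> bool" where
  "regular_clock c \<longleftrightarrow> continuous_on {0..} c \<and> strict_mono_on {0..} c \<and> c 0 = 0 \<and> (\<forall>t. \<exists>u\<ge>0. t \<le> c u)"

lemma regular_clock_less_iff:
  assumes "regular_clock c" "u \<ge> 0" "v \<ge> 0"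
  shows "c u < c v \<longleftrightarrow> u < v"
  using assms unfolding regular_clock_def
  by (metis atLeast_iff linorder_less_linear less_asym strict_mono_onD less_irrefl)

lemma regular_clock_inv:
  assumes c: "regular_clock c" and t: "t \<ge> 0"
  shows "inv_into {0..} c t \<ge> 0" "c (inv_into {0..} c t) = t"
proof -
  obtain u where u: "u \<ge> 0" "t \<le> c u" using c by (auto simp: regular_clock_def)
  have "continuous_on {0..u} c" using c continuous_on_subset by (fastforce simp: regular_clock_def)
  then obtain x where "0 \<le> x" "c x = t"
    using IVT'[of c 0 t u] u t c by (auto simp: regular_clock_def)
  then have "t \<in> c ` {0..}" by auto
  then show "inv_into {0..} c t \<ge> 0" "c (inv_into {0..} c t) = t"
    using inv_into_into[of t c "{0..}"] f_inv_into_f[of t c "{0..}"] by auto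
qed

lemma regular_clock_inv_eqI:
  assumes c: "regular_clock c" and u: "u \<ge> 0" "c u = t"
  shows "inv_into {0..} c t = u"
proof -
  have "t \<ge> 0" using regular_clock_less_iff[OF c u(1), of 0] u c
    by (auto simp: regular_clock_def not_less[symmetric])
  from regular_clock_inv[OF c this] show ?thesis
    using regular_clock_less_iff[OF c u(1), of "inv_into {0..} c t"]
      regular_clock_less_iff[OF c, of "inv_into {0..} c t" u] u by (metis less_irrefl linorder_less_linear)
qed

lemma regular_clock_inv_less_iff:
  assumes c: "regular_clock c" and t: "t \<ge> 0" and u: "u \<ge> 0"
  shows "inv_into {0..} c t < u \<longleftrightarrow> t < c u" "u < inv_into {0..} c t \<longleftrightarrow> c u < t"
  using regular_clock_less_iff[OF c regular_clock_inv(1)[OF c t] u]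
    regular_clock_less_iff[OF c u regular_clock_inv(1)[OF c t]] regular_clock_inv(2)[OF c t] by auto

lemma regular_clock_inv_mono:
  assumes c: "regular_clock c" and t: "0 \<le> s" "s \<le> t"
  shows "inv_into {0..} c s \<le> inv_into {0..} c t"
  using regular_clock_inv_less_iff(1)[OF c _ regular_clock_inv(1)[OF c], of t s] t
    regular_clock_inv(2)[OF c] by (auto simp: not_less[symmetric])

text \<open>Let \<open>d > 0\<close> be the minimum of \<open>c (u + e) - c u\<close> for \<open>u\<close> between \<open>0\<close> and the inverse of \<open>c\<close> at \<open>T\<close>.
  If \<open>C n\<close> differs from \<open>c\<close> by less than \<open>d\<close>, then \<open>C n (s - e) < t < C n (s + e)\<close> with \<open>s\<close> the
  inverse of \<open>c\<close> at \<open>t\<close>, so the inverse of \<open>C n\<close> at \<open>t\<close> is within \<open>e\<close> of \<open>s\<close>.\<close>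

lemma inv_regular_clock_uniform_limit:
  assumes C: "\<And>n. regular_clock (C n)" and c: "regular_clock c"
    and lim: "\<And>U. uniform_limit {0..U} C c sequentially" and T: "T \<ge> 0"
  shows "uniform_limit {0..T} (\<lambda>n. inv_into {0..} (C n)) (inv_into {0..} c) sequentially"
proof (rule uniform_limitI)
  fix e :: real assume e: "e > 0"
  define S where "S = inv_into {0..} c T"
  have S: "S \<ge> 0" unfolding S_def by (rule regular_clock_inv[OF c T])
  have cc: "continuous_on {0..} c" using c by (simp add: regular_clock_def)
  have "continuous_on {0..S} (\<lambda>u. c (u + e) - c u)"
  proof (rule continuous_on_diff)
    show "continuous_on {0..S} (\<lambda>u. c (u + e))"
      by (rule continuous_on_compose2[OF cc]) (use e in \<open>auto intro!: continuous_intros\<close>)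
    show "continuous_on {0..S} c" by (rule continuous_on_subset[OF cc]) auto
  qed
  from continuous_attains_inf[OF _ _ this] S obtain u0 where
    u0: "u0 \<in> {0..S}" "\<And>u. u \<in> {0..S} \<Longrightarrow> c (u0 + e) - c u0 \<le> c (u + e) - c u"
    by auto
  define d where "d = c (u0 + e) - c u0"
  have d: "d > 0" using regular_clock_less_iff[OF c, of u0 "u0 + e"] u0(1) e by (simp add: d_def)
  have "\<forall>\<^sub>F n in sequentially. \<forall>u\<in>{0..S + e}. dist (C n u) (c u) < d"
    using lim[of "S + e"] d unfolding uniform_limit_iff by blast
  then show "\<forall>\<^sub>F n in sequentially. \<forall>t\<in>{0..T}. dist (inv_into {0..} (C n) t) (inv_into {0..} c t) < e"
  proof eventually_elim
    case (elim n)
    have close: "\<bar>C n u - c u\<bar> < d" if "0 \<le> u" "u \<le> S + e" for u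
      using bspec[OF elim, of u] that unfolding dist_real_def by simp
    show ?case
    proof
      fix t assume t: "t \<in> {0..T}"
      define s where "s = inv_into {0..} c t"
      have s: "s \<ge> 0" "c s = t" "s \<le> S"
        using regular_clock_inv[OF c, of t] regular_clock_inv_mono[OF c, of t T] t
        by (auto simp: s_def S_def)
      have "c (s + e) - c s \<ge> d" using u0(2)[of s] s by (simp add: d_def)
      moreover have "\<bar>C n (s + e) - c (s + e)\<bar> < d" using close[of "s + e"] s e by simp
      ultimately have "t < C n (s + e)" using s by linarith
      then have upper: "inv_into {0..} (C n) t < s + e"
        using regular_clock_inv_less_iff(1)[OF C, of t "s + e" n] t s e by simp
      have lower: "s - e < inv_into {0..} (C n) t"
      proof (cases "s \<ge> e")
        case True
        have "c (s - e + e) - c (s - e) \<ge> d" using u0(2)[of "s - e"] s True e by (simp add: d_def)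
        moreover have "\<bar>C n (s - e) - c (s - e)\<bar> < d" using close[of "s - e"] s e True by simp
        ultimately have "C n (s - e) < t" using s by simp
        then show ?thesis
          using regular_clock_inv_less_iff(2)[OF C, of t "s - e" n] t True by simp
      next
        case False
        then show ?thesis using regular_clock_inv(1)[OF C, of t n] t by simp
      qed
      show "dist (inv_into {0..} (C n) t) (inv_into {0..} c t) < e"
        using upper lower by (simp add: dist_real_def s_def abs_less_iff)
    qed
  qed
qed

lemma continuous_on_inv_regular_clock:
  assumes c: "regular_clock c"
  shows "continuous_on {0..} (inv_into {0..} c)"
  unfolding continuous_on_iff
proof (intro ballI allI impI)
  fix t e :: real assume t: "t \<in> {0..}" and e: "e > 0"
  define s where "s = inv_into {0..} c t"
  have s: "s \<ge> 0" "c s = t" using regular_clock_inv[OF c] t by (auto simp: s_def)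
  have up: "t < c (s + e)" using regular_clock_less_iff[OF c, of s "s + e"] s e by simp
  define l where "l = (if s \<ge> e then t - c (s - e) else 1)"
  have l: "l > 0" using regular_clock_less_iff[OF c, of "s - e" s] s e by (simp add: l_def)
  show "\<exists>d>0. \<forall>x'\<in>{0..}. dist x' t < d \<longrightarrow> dist (inv_into {0..} c x') (inv_into {0..} c t) < e"
  proof (intro exI[of _ "min (c (s + e) - t) l"] conjI ballI impI)
    fix x assume x: "x \<in> {0..}" "dist x t < min (c (s + e) - t) l"
    then have "x < c (s + e)" by (auto simp: dist_real_def)
    then have upper: "inv_into {0..} c x < s + e"
      using regular_clock_inv_less_iff(1)[OF c, of x "s + e"] x s e by simp
    have lower: "s - e < inv_into {0..} c x"
    proof (cases "s \<ge> e")
      case True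
      then have "c (s - e) < x" using x by (auto simp: dist_real_def l_def)
      then show ?thesis
        using regular_clock_inv_less_iff(2)[OF c, of x "s - e"] x True by simp
    next
      case False
      then show ?thesis using regular_clock_inv(1)[OF c, of x] x by simp
    qed
    show "dist (inv_into {0..} c x) (inv_into {0..} c t) < e"
      using upper lower by (simp add: dist_real_def s_def abs_less_iff)
  qed (use up l in auto)
qed

lemma uniform_limit_time_change:
  fixes w :: "real \<Rightarrow> real"
  assumes w: "continuous_on {0..} w"
    and C: "\<And>n. regular_clock (C n)" and c: "regular_clock c"
    and lim: "\<And>U. uniform_limit {0..U} C c sequentially" and T: "T \<ge> 0"
  shows "uniform_limit {0..T} (\<lambda>n t. w (inv_into {0..} (C n) t)) (\<lambda>t. w (inv_into {0..} c t)) sequentially"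
proof -
  define S where "S = inv_into {0..} c T"
  have ul: "uniform_limit {0..T} (\<lambda>n. inv_into {0..} (C n)) (inv_into {0..} c) sequentially"
    by (rule inv_regular_clock_uniform_limit[OF C c lim T])
  have uc: "uniformly_continuous_on {0..S + 1} w"
    by (rule compact_uniformly_continuous[OF continuous_on_subset[OF w]]) auto
  have "\<forall>\<^sub>F n in sequentially. \<forall>t\<in>{0..T}. dist (inv_into {0..} (C n) t) (inv_into {0..} c t) < 1"
    using ul unfolding uniform_limit_iff by (rule allE[of _ 1]) simp
  then have ev: "\<forall>\<^sub>F n in sequentially. \<forall>t\<in>{0..T}. inv_into {0..} (C n) t \<in> {0..S + 1}"
  proof eventually_elim
    case (elim n)
    show ?case
    proof
      fix t assume t: "t \<in> {0..T}"
      have "inv_into {0..} c t \<le> S" using regular_clock_inv_mono[OF c, of t T] t by (simp add: S_def)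
      moreover have "dist (inv_into {0..} (C n) t) (inv_into {0..} c t) < 1" by (rule bspec[OF elim t])
      then have "\<bar>inv_into {0..} (C n) t - inv_into {0..} c t\<bar> < 1" by (simp only: dist_real_def)
      moreover have "inv_into {0..} (C n) t \<ge> 0" using regular_clock_inv(1)[OF C, of t n] t by simp
      ultimately have "0 \<le> inv_into {0..} (C n) t \<and> inv_into {0..} (C n) t \<le> S + 1"
        by linarith
      then show "inv_into {0..} (C n) t \<in> {0..S + 1}" by simp
    qed
  qed
  show ?thesis
    by (rule uniform_limit_compose_uniformly_continuous_on[OF ul uc ev]) simp
qed

lemma clock_cong:
  "(\<And>s. s \<ge> 0 \<Longrightarrow> B s \<omega> = C s \<omega>') \<Longrightarrow> clock lam B u \<omega> = clock lam C u \<omega>'"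
  unfolding clock_def by (intro nn_integral_cong) (simp add: indicator_def)

lemma clock_mono: "u \<le> v \<Longrightarrow> clock lam B u \<omega> \<le> clock lam B v \<omega>"
  unfolding clock_def by (intro nn_integral_mono) (auto simp: indicator_def)

text \<open>Extending the path by its initial value to negative times gives a function that is continuous,
  hence measurable, on the whole line.\<close>

lemma borel_measurable_extended_path:
  fixes w :: "real \<Rightarrow> real"
  assumes "continuous_on {0..} w"
  shows "(\<lambda>s. w (max 0 s)) \<in> borel_measurable borel"
proof (rule borel_measurable_continuous_onI, rule continuous_on_compose2[OF assms])
  show "continuous_on UNIV (\<lambda>s::real. max 0 s)" by (intro continuous_intros)
qed auto

text \<open>On \<open>{0..u}\<close> the discount is at least \<open>exp (- u)\<close>.\<close>

lemma clock_le_add_clock_defect: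
  assumes B: "continuous_on {0..} (\<lambda>s. B s \<omega>)"
    and lam [measurable]: "lam \<in> borel_measurable borel" "lam' \<in> borel_measurable borel"
    and pos: "\<And>x. lam x > 0" "\<And>x. lam' x > 0"
  shows "clock lam B u \<omega> \<le> clock lam' B u \<omega> + ennreal (exp u) * clock_defect lam lam' B \<omega>"
proof -
  define p where "p s = B (max 0 s) \<omega>" for s
  have [measurable]: "p \<in> borel_measurable borel"
    unfolding p_def by (rule borel_measurable_extended_path[OF B])
  let ?h = "\<lambda>s. ennreal (exp (- s)) * ennreal \<bar>inverse (lam (p s)) - inverse (lam' (p s))\<bar> * indicator {0..} s"
  have "clock lam B u \<omega> = (\<integral>\<^sup>+s. ennreal (inverse (lam (p s))) * indicator {0..u} s \<partial>lborel)"
    unfolding clock_def by (intro nn_integral_cong) (simp add: p_def indicator_def)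
  also have "\<dots> \<le> (\<integral>\<^sup>+s. ennreal (inverse (lam' (p s))) * indicator {0..u} s + ennreal (exp u) * ?h s \<partial>lborel)"
  proof (intro nn_integral_mono)
    fix s
    show "ennreal (inverse (lam (p s))) * indicator {0..u} s \<le>
      ennreal (inverse (lam' (p s))) * indicator {0..u} s + ennreal (exp u) * ?h s"
    proof (cases "s \<in> {0..u}")
      case True
      let ?d = "\<bar>inverse (lam (p s)) - inverse (lam' (p s))\<bar>"
      have "1 * ?d \<le> (exp u * exp (- s)) * ?d"
        using True by (intro mult_right_mono) (auto simp: exp_add[symmetric])
      then have "inverse (lam (p s)) \<le> inverse (lam' (p s)) + exp u * (exp (- s) * ?d)"
        by (simp add: mult.assoc)
      then have "ennreal (inverse (lam (p s))) \<le> ennreal (inverse (lam' (p s)) + exp u * (exp (- s) * ?d))"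
        by (rule ennreal_leI)
      also have "\<dots> = ennreal (inverse (lam' (p s))) + ennreal (exp u) * (ennreal (exp (- s)) * ennreal ?d)"
        using pos(2)[of "p s"] by (simp add: ennreal_mult ennreal_plus less_imp_le)
      finally show ?thesis using True by simp
    qed (simp)
  qed
  also have "\<dots> = (\<integral>\<^sup>+s. ennreal (inverse (lam' (p s))) * indicator {0..u} s \<partial>lborel) +
      ennreal (exp u) * (\<integral>\<^sup>+s. ?h s \<partial>lborel)"
    by (subst nn_integral_add, measurable, subst nn_integral_cmult) auto
  also have "(\<integral>\<^sup>+s. ennreal (inverse (lam' (p s))) * indicator {0..u} s \<partial>lborel) = clock lam' B u \<omega>"
    unfolding clock_def by (intro nn_integral_cong) (simp add: p_def indicator_def)
  also have "(\<integral>\<^sup>+s. ?h s \<partial>lborel) = clock_defect lam lam' B \<omega>"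
    unfolding clock_defect_def by (intro nn_integral_cong) (simp add: p_def indicator_def)
  finally show ?thesis .
qed

lemma clock_defect_commute: "clock_defect lam lam' B \<omega> = clock_defect lam' lam B \<omega>"
  unfolding clock_defect_def by (simp add: abs_minus_commute)

text \<open>A clock is an indefinite integral, hence continuous, and it increases strictly because its
  integrand is positive.\<close>

lemma regular_clock_enn2real_clock:
  assumes B: "continuous_on {0..} (\<lambda>s. B s \<omega>)"
    and lam [measurable]: "lam \<in> borel_measurable borel" and pos: "\<And>x. lam x > 0"
    and fin: "\<And>u. clock lam B u \<omega> < \<infinity>"
    and unbounded: "\<And>t :: real. \<exists>u. ennreal t \<le> clock lam B u \<omega>"
  shows "regular_clock (\<lambda>u. enn2real (clock lam B u \<omega>))"
proof -
  define p where "p s = B (max 0 s) \<omega>" for s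
  have [measurable]: "p \<in> borel_measurable borel"
    unfolding p_def by (rule borel_measurable_extended_path[OF B])
  define f where "f s = inverse (lam (p s))" for s
  have f: "f s > 0" for s using pos[of "p s"] by (simp add: f_def)
  have [measurable]: "f \<in> borel_measurable borel" unfolding f_def by measurable
  define c where "c u = enn2real (clock lam B u \<omega>)" for u
  have clock: "clock lam B u \<omega> = (\<integral>\<^sup>+s\<in>{0..u}. ennreal (f s) \<partial>lborel)" for u
    unfolding clock_def by (intro nn_integral_cong) (simp add: f_def p_def indicator_def)
  have c: "clock lam B u \<omega> = ennreal (c u)" for u using fin[of u] by (simp add: c_def)
  have c_nonneg: "c u \<ge> 0" for u by (simp add: c_def)
  have int: "set_integrable lborel {0..u} f" for u
    unfolding set_integrable_def integrable_iff_bounded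
  proof
    have "(\<integral>\<^sup>+s. ennreal (norm (indicator {0..u} s *\<^sub>R f s)) \<partial>lborel) = clock lam B u \<omega>"
      unfolding clock using f by (intro nn_integral_cong) (auto simp: indicator_def less_imp_le)
    then show "(\<integral>\<^sup>+s. ennreal (norm (indicator {0..u} s *\<^sub>R f s)) \<partial>lborel) < \<infinity>" using fin by simp
  qed measurable
  have c_int: "c u = integral {0..u} f" for u
  proof -
    have "c u = (LBINT s:{0..u}. f s)"
      unfolding c_def clock set_lebesgue_integral_def using f
      by (subst integral_eq_nn_integral)
        (auto intro!: arg_cong[where f=enn2real] nn_integral_cong simp: indicator_def less_imp_le)
    also have "\<dots> = integral {0..u} f" by (rule set_borel_integral_eq_integral(2)[OF int])
    finally show ?thesis .
  qed
  have cont: "continuous_on {0..} c"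
    unfolding continuous_on_eq_continuous_within
  proof
    fix x :: real assume x: "x \<in> {0..}"
    have "continuous_on {0..x + 1} c"
      unfolding c_int by (intro indefinite_integral_continuous_1 set_borel_integral_eq_integral(1)[OF int])
    then have "continuous (at x within {0..x + 1}) c"
      using x by (auto simp: continuous_on_eq_continuous_within)
    moreover have "at x within {0..x + 1} = at x within {0..}"
      by (rule at_within_nhd[of x "{..<x + 1}"]) auto
    ultimately show "continuous (at x within {0..}) c" by simp
  qed
  have mono: "strict_mono_on {0..} c"
  proof (rule strict_mono_onI)
    fix u v :: real assume uv: "u \<in> {0..}" "v \<in> {0..}" "u < v"
    have "clock lam B v \<omega> =
        (\<integral>\<^sup>+s. ennreal (f s) * indicator {0..u} s + ennreal (f s) * indicator {u<..v} s \<partial>lborel)"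
      unfolding clock using uv by (intro nn_integral_cong) (auto simp: indicator_def)
    also have "\<dots> = clock lam B u \<omega> + (\<integral>\<^sup>+s\<in>{u<..v}. ennreal (f s) \<partial>lborel)"
      unfolding clock by (rule nn_integral_add) measurable
    finally have split: "clock lam B v \<omega> = clock lam B u \<omega> + (\<integral>\<^sup>+s\<in>{u<..v}. ennreal (f s) \<partial>lborel)" .
    have "(\<integral>\<^sup>+s\<in>{u<..v}. ennreal (f s) \<partial>lborel) \<noteq> 0"
    proof
      assume "(\<integral>\<^sup>+s\<in>{u<..v}. ennreal (f s) \<partial>lborel) = 0"
      then have "AE s in lborel. ennreal (f s) * indicator {u<..v} s = 0"
        by (subst (asm) nn_integral_0_iff_AE) auto
      then have "AE s in lborel. s \<notin> {u<..v}"
      proof eventually_elim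
        case (elim s)
        then show ?case using f[of s] by (auto simp: indicator_def split: if_splits)
      qed
      then have "emeasure lborel {u<..v} = 0" by (subst (asm) AE_iff_measurable[of "{u<..v}"]) auto
      then show False using uv by (simp add: emeasure_lborel_Ioc)
    qed
    then have "clock lam B u \<omega> \<noteq> clock lam B v \<omega>"
      unfolding split using fin[of u] by (simp add: less_top )
    moreover have "clock lam B u \<omega> \<le> clock lam B v \<omega>" using uv by (intro clock_mono) simp
    ultimately show "c u < c v" unfolding c using c_nonneg by simp
  qed
  have "c 0 = 0"
  proof -
    have "clock lam B 0 \<omega> = (\<integral>\<^sup>+(s::real). 0 \<partial>lborel)"
      unfolding clock
    proof (rule nn_integral_cong_AE)
      have "AE s in lborel. s \<noteq> (0::real)" by (rule AE_lborel_singleton)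
      then show "AE s in lborel. ennreal (f s) * indicator {0..0} s = 0"
        by eventually_elim auto
    qed
    then show ?thesis by (simp add: c_def)
  qed
  moreover have "\<exists>u\<ge>0. t \<le> c u" for t
  proof -
    obtain u where "ennreal t \<le> clock lam B u \<omega>" using unbounded by blast
    also have "\<dots> \<le> clock lam B (max 0 u) \<omega>" by (rule clock_mono) simp
    finally have "t \<le> c (max 0 u)" unfolding c using c_nonneg by (simp add: ennreal_le_iff)
    then show ?thesis by (intro exI[of _ "max 0 u"]) simp
  qed
  ultimately show ?thesis
    using cont mono unfolding regular_clock_def c_def by blast
qed

text \<open>The clock exceeds \<open>t\<close> exactly at the times beyond the inverse of the clock at \<open>t\<close>.\<close>

lemma tau_eq_inv_clock:
  assumes c: "regular_clock (\<lambda>u. enn2real (clock lam B u \<omega>))"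
    and fin: "\<And>u. clock lam B u \<omega> < \<infinity>" and t: "t \<ge> 0"
  shows "tau lam B t \<omega> = ereal (inv_into {0..} (\<lambda>u. enn2real (clock lam B u \<omega>)) t)" (is "_ = ereal ?g")
proof -
  have g: "?g \<ge> 0" by (rule regular_clock_inv[OF c t])
  have "{u. 0 < u \<and> ennreal t < clock lam B u \<omega>} = {?g<..}"
  proof (intro set_eqI iffI)
    fix u assume "u \<in> {u. 0 < u \<and> ennreal t < clock lam B u \<omega>}"
    then have u: "0 < u" "ennreal t < clock lam B u \<omega>" by auto
    then have "t < enn2real (clock lam B u \<omega>)"
      using fin[of u] t by (metis ennreal_enn2real ennreal_less_iff infinity_ennreal_def)
    then show "u \<in> {?g<..}" using regular_clock_inv_less_iff(1)[OF c t, of u] u by simp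
  next
    fix u assume u: "u \<in> {?g<..}"
    then have "t < enn2real (clock lam B u \<omega>)"
      using regular_clock_inv_less_iff(1)[OF c t, of u] g by simp
    then have "ennreal t < clock lam B u \<omega>"
      using fin[of u] t by (metis ennreal_enn2real ennreal_less_iff infinity_ennreal_def)
    then show "u \<in> {u. 0 < u \<and> ennreal t < clock lam B u \<omega>}" using u g by simp
  qed
  then have "tau lam B t \<omega> = (INF u\<in>{?g<..}. ereal u)" by (simp add: tau_def)
  also have "\<dots> = ereal ?g"
  proof (rule antisym)
    show "(INF u\<in>{?g<..}. ereal u) \<le> ereal ?g"
    proof (rule dense_ge)
      fix x assume "ereal ?g < x"
      then show "(INF u\<in>{?g<..}. ereal u) \<le> x"
        by (cases x) (auto intro: INF_lower2)
    qed
    show "ereal ?g \<le> (INF u\<in>{?g<..}. ereal u)"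
      by (intro INF_greatest) (simp add: less_imp_le)
  qed
  finally show ?thesis .
qed

lemma time_changed_eq_inv_clock:
  assumes "regular_clock (\<lambda>u. enn2real (clock lam B u \<omega>))"
    and "\<And>u. clock lam B u \<omega> < \<infinity>" and "t \<ge> 0"
  shows "time_changed lam B t \<omega> = B (inv_into {0..} (\<lambda>u. enn2real (clock lam B u \<omega>)) t) \<omega>"
  by (simp add: time_changed_def tau_eq_inv_clock[OF assms])

section \<open>Brownian scaling and regularity of the clock\<close>

definition brownian_scaling :: "real \<Rightarrow> (real \<Rightarrow> 'a \<Rightarrow> real) \<Rightarrow> real \<Rightarrow> 'a \<Rightarrow> real" where
  "brownian_scaling k B t \<omega> = B (k * t) \<omega> / sqrt k"

lemma continuous_on_brownian_scaling:
  assumes "continuous_on {0..} (\<lambda>t. B t \<omega>)" "k > 0"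
  shows "continuous_on {0..} (\<lambda>t. brownian_scaling k B t \<omega>)"
proof -
  have "continuous_on {0..} (\<lambda>t. B (k * t) \<omega>)"
    by (rule continuous_on_compose2[OF assms(1)]) (use assms(2) in \<open>auto intro!: continuous_intros\<close>)
  then have "continuous_on {0..} (\<lambda>t. B (k * t) \<omega> * inverse (sqrt k))"
    by (rule continuous_on_mult_right)
  then show ?thesis
    by (simp add: brownian_scaling_def divide_inverse)
qed

lemma wiener_process_increment:
  assumes "wiener_process M B" "0 \<le> s" "s < t"
  shows "distributed M lborel (\<lambda>\<omega>. B t \<omega> - B s \<omega>) (normal_density 0 (sqrt (t - s)))"
  using assms by (simp add: wiener_process_def)

lemma wiener_process_indep_increments:
  fixes p :: "nat \<Rightarrow> real"
  assumes "wiener_process M B" "0 \<le> p 0" "strict_mono_on {..n} p"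
  shows "prob_space.indep_vars M (\<lambda>_. borel) (\<lambda>i \<omega>. B (p (Suc i)) \<omega> - B (p i) \<omega>) {..<n}"
  using assms by (simp add: wiener_process_def)

lemma wiener_process_brownian_scaling:
  assumes W: "wiener_process M B" and k: "k > 0"
  shows "wiener_process M (brownian_scaling k B)"
  unfolding wiener_process_def
proof (intro conjI allI impI)
  show M: "prob_space M" using W by (simp add: wiener_process_def)
  interpret prob_space M by fact
  show "brownian_scaling k B t \<in> borel_measurable M" if "t \<ge> 0" for t
  proof -
    have [measurable]: "B (k * t) \<in> borel_measurable M" using W k that by (simp add: wiener_process_def)
    show ?thesis unfolding brownian_scaling_def by measurable
  qed
  have "AE \<omega> in M. B 0 \<omega> = 0" using W by (simp add: wiener_process_def)
  then show "AE \<omega> in M. brownian_scaling k B 0 \<omega> = 0"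
    by eventually_elim (simp add: brownian_scaling_def)
  show "AE \<omega> in M. continuous_on {0..} (\<lambda>t. brownian_scaling k B t \<omega>)"
    using wiener_process_continuous_path[OF W]
    by eventually_elim (rule continuous_on_brownian_scaling[OF _ k])
  fix s t :: real assume st: "0 \<le> s \<and> s < t"
  have "distributed M lborel (\<lambda>\<omega>. B (k * t) \<omega> - B (k * s) \<omega>) (normal_density 0 (sqrt (k * t - k * s)))"
    by (rule wiener_process_increment[OF W]) (use st k in auto)
  from normal_density_affine[OF this, of "1 / sqrt k" 0] k st
  have "distributed M lborel (\<lambda>\<omega>. 0 + 1 / sqrt k * (B (k * t) \<omega> - B (k * s) \<omega>))
      (normal_density (0 + 1 / sqrt k * 0) (\<bar>1 / sqrt k\<bar> * sqrt (k * t - k * s)))"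
    by simp
  moreover have "\<bar>1 / sqrt k\<bar> * sqrt (k * t - k * s) = sqrt (t - s)"
    using k by (simp add: right_diff_distrib[symmetric] real_sqrt_mult)
  ultimately show "distributed M lborel (\<lambda>\<omega>. brownian_scaling k B t \<omega> - brownian_scaling k B s \<omega>)
      (normal_density 0 (sqrt (t - s)))"
    by (simp add: brownian_scaling_def diff_divide_distrib)
next
  fix n :: nat and p :: "nat \<Rightarrow> real"
  assume p: "0 \<le> p 0 \<and> strict_mono_on {..n} p"
  interpret prob_space M using W by (simp add: wiener_process_def)
  have "indep_vars (\<lambda>_. borel) (\<lambda>i \<omega>. B (k * p (Suc i)) \<omega> - B (k * p i) \<omega>) {..<n}"
    by (rule wiener_process_indep_increments[OF W, of "\<lambda>i. k * p i"])
      (use p k in \<open>auto simp: strict_mono_on_def\<close>)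
  from indep_vars_compose2[OF this, of "\<lambda>_ x. x / sqrt k" "\<lambda>_. borel"]
  have "indep_vars (\<lambda>_. borel) (\<lambda>i \<omega>. (B (k * p (Suc i)) \<omega> - B (k * p i) \<omega>) / sqrt k) {..<n}"
    by simp
  then show "indep_vars (\<lambda>_. borel)
      (\<lambda>i \<omega>. brownian_scaling k B (p (Suc i)) \<omega> - brownian_scaling k B (p i) \<omega>) {..<n}"
    by (simp only: brownian_scaling_def diff_divide_distrib)
qed

lemma clock_brownian_scaling:
  assumes B: "continuous_on {0..} (\<lambda>s. B s \<omega>)" and lam [measurable]: "lam \<in> borel_measurable borel"
    and k: "k > 0"
  shows "clock lam B (k * u) \<omega> = ennreal k * clock (\<lambda>x. lam (sqrt k * x)) (brownian_scaling k B) u \<omega>"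
proof -
  define p where "p s = B (max 0 s) \<omega>" for s
  have [measurable]: "p \<in> borel_measurable borel"
    unfolding p_def by (rule borel_measurable_extended_path[OF B])
  have "clock lam B (k * u) \<omega> = (\<integral>\<^sup>+s. ennreal (inverse (lam (p s))) * indicator {0..k * u} s \<partial>lborel)"
    unfolding clock_def by (intro nn_integral_cong) (simp add: p_def indicator_def)
  also have "\<dots> = ennreal \<bar>k\<bar> *
      (\<integral>\<^sup>+s. ennreal (inverse (lam (p (0 + k * s)))) * indicator {0..k * u} (0 + k * s) \<partial>lborel)"
    by (rule nn_integral_real_affine) (use k in auto)
  also have "(\<integral>\<^sup>+s. ennreal (inverse (lam (p (0 + k * s)))) * indicator {0..k * u} (0 + k * s) \<partial>lborel) =
      clock (\<lambda>x. lam (sqrt k * x)) (brownian_scaling k B) u \<omega>"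
    unfolding clock_def
    using k by (intro nn_integral_cong) (auto simp: p_def brownian_scaling_def indicator_def zero_le_mult_iff)
  finally show ?thesis using k by simp
qed

lemma admissible_rate_mult:
  assumes lam: "admissible_rate lam ap am" and c: "c > 0"
  shows "admissible_rate (\<lambda>x. lam (c * x)) ap am"
  unfolding admissible_rate_def
proof (intro conjI allI impI)
  have [measurable]: "lam \<in> borel_measurable borel" using lam by (simp add: admissible_rate_def)
  show "(\<lambda>x. lam (c * x)) \<in> borel_measurable borel" by measurable
  show "0 < lam (c * x)" for x using lam by (simp add: admissible_rate_def)
  show "0 < ap" "0 < am" using lam by (auto simp: admissible_rate_def)
  show "((\<lambda>x. lam (c * x)) \<longlongrightarrow> ap) at_top"
    using lam c by (auto simp: admissible_rate_def
      intro!: filterlim_compose[of lam _ at_top] filterlim_tendsto_pos_mult_at_top[OF tendsto_const] filterlim_ident)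
  show "((\<lambda>x. lam (c * x)) \<longlongrightarrow> am) at_bot"
    using lam c by (auto simp: admissible_rate_def
      intro!: filterlim_compose[of lam _ at_bot] filterlim_tendsto_pos_mult_at_bot[OF tendsto_const] filterlim_ident)
  fix K :: "real set" assume "compact K"
  then have "set_integrable lborel ((*) c ` K) (\<lambda>x. 1 / lam x)"
    using lam compact_scaling[of K c] by (auto simp: admissible_rate_def)
  then have "integrable lborel (\<lambda>x. indicator ((*) c ` K) (0 + c * x) *\<^sub>R (1 / lam (0 + c * x)))"
    unfolding set_integrable_def by (rule lborel_integrable_real_affine) (use c in simp)
  moreover have "indicator ((*) c ` K) (0 + c * x) = (indicator K x :: real)" for x
    using c by (auto simp: indicator_def)
  ultimately show "set_integrable lborel K (\<lambda>x. 1 / lam (c * x))"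
    by (simp add: set_integrable_def)
qed

lemma admissible_step_rate:
  assumes "0 < ap" "0 < am"
  shows "admissible_rate (step_rate ap am) ap am"
  unfolding admissible_rate_def
proof (intro conjI allI impI)
  show "0 < step_rate ap am x" for x using assms by (simp add: step_rate_def)
  show "(step_rate ap am \<longlongrightarrow> ap) at_top"
    by (rule tendsto_eventually, rule eventually_mono[OF eventually_gt_at_top[of 0]])
      (simp add: step_rate_def)
  show "(step_rate ap am \<longlongrightarrow> am) at_bot"
    by (rule tendsto_eventually, rule eventually_mono[OF eventually_le_at_bot[of 0]])
      (simp add: step_rate_def)
  fix K :: "real set" assume K: "compact K"
  have [measurable]: "K \<in> sets borel" using K by (simp add: borel_compact)
  show "set_integrable lborel K (\<lambda>x. 1 / step_rate ap am x)"
    unfolding set_integrable_def integrable_iff_bounded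
  proof
    have "(\<integral>\<^sup>+x. ennreal (norm (indicator K x *\<^sub>R (1 / step_rate ap am x))) \<partial>lborel) \<le>
        (\<integral>\<^sup>+x. ennreal (1 / ap + 1 / am) * indicator K x \<partial>lborel)"
      using assms by (intro nn_integral_mono) (auto simp: indicator_def step_rate_def intro!: ennreal_leI)
    also have "\<dots> = ennreal (1 / ap + 1 / am) * emeasure lborel K"
      by (rule nn_integral_cmult_indicator) measurable
    also have "\<dots> < \<infinity>"
      using emeasure_bounded_finite[OF compact_imp_bounded[OF K]] by (simp add: ennreal_mult_less_top)
    finally show "(\<integral>\<^sup>+x. ennreal (norm (indicator K x *\<^sub>R (1 / step_rate ap am x))) \<partial>lborel) < \<infinity>" .
  qed measurable
qed (use assms in auto)

lemma clock_step_rate_finite: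
  assumes "0 < ap" "0 < am"
  shows "clock (step_rate ap am) B u \<omega> < \<infinity>"
proof -
  have "clock (step_rate ap am) B u \<omega> \<le> (\<integral>\<^sup>+s. ennreal (1 / ap + 1 / am) * indicator {0..u} s \<partial>lborel)"
    unfolding clock_def using assms
    by (intro nn_integral_mono mult_right_mono ennreal_leI) (auto simp: step_rate_def inverse_eq_divide)
  also have "\<dots> = ennreal (1 / ap + 1 / am) * emeasure lborel {0..u}"
    by (rule nn_integral_cmult_indicator) simp
  also have "\<dots> < \<infinity>" by (simp add: ennreal_mult_less_top emeasure_lborel_Icc_eq)
  finally show ?thesis .
qed

lemma clock_step_rate_1_ge:
  assumes "0 < ap" "0 < am"
  shows "ennreal (min (inverse ap) (inverse am)) \<le> clock (step_rate ap am) B 1 \<omega>"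
proof -
  have "ennreal (min (inverse ap) (inverse am)) =
      (\<integral>\<^sup>+s. ennreal (min (inverse ap) (inverse am)) * indicator {0..1::real} s \<partial>lborel)"
    by (subst nn_integral_cmult_indicator) auto
  also have "\<dots> \<le> clock (step_rate ap am) B 1 \<omega>"
    unfolding clock_def
    by (intro nn_integral_mono mult_right_mono ennreal_leI) (auto simp: step_rate_def)
  finally show ?thesis .
qed

text \<open>The clock of \<open>B\<close> at time \<open>k\<close> is \<open>k\<close> times the clock at time \<open>1\<close> of the rescaled process with the
  rate \<open>\<lambda>x. lam (sqrt k * x)\<close>. Along a subsequence the latter is almost surely close to the clock of
  the step rate, which is at least \<open>min (1 / ap) (1 / am)\<close> at time \<open>1\<close>; hence the clock of \<open>B\<close> grows
  linearly along the subsequence.\<close>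

lemma clock_unbounded_AE:
  assumes W: "wiener_process M B" and lam: "admissible_rate lam ap am"
  shows "AE \<omega> in M. \<forall>t :: real. \<exists>u. ennreal t \<le> clock lam B u \<omega>"
proof -
  have M: "prob_space M" using W by (simp add: wiener_process_def)
  have lam_m: "lam \<in> borel_measurable borel" and pos: "\<And>x. lam x > 0" "ap > 0" "am > 0"
    using lam by (auto simp: admissible_rate_def)
  have step_pos: "step_rate ap am x > 0" for x using pos by (simp add: step_rate_def)
  let ?V = "\<lambda>n. brownian_scaling (real (Suc n)) B"
  let ?l = "\<lambda>n x. lam (sqrt (real (Suc n)) * x)"
  have V: "wiener_process M (?V n)" for n by (rule wiener_process_brownian_scaling[OF W]) simp
  have lim: "filterlim (\<lambda>n. sqrt (real (Suc n))) at_top sequentially"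
    by (intro filterlim_compose[OF sqrt_at_top] filterlim_compose[OF filterlim_real_sequentially filterlim_Suc])
  obtain r where r: "strict_mono r"
    "AE \<omega> in M. (\<lambda>n. clock_defect (?l (r n)) (step_rate ap am) (?V (r n)) \<omega>) \<longlonglongrightarrow> 0"
    using clock_defect_subseq_AE_tendsto_0[where V="?V" and c="\<lambda>n. sqrt (real (Suc n))", OF M V lam _ lim]
    by auto
  from r(2) wiener_process_continuous_path[OF W] show ?thesis
  proof eventually_elim
    case (elim \<omega>)
    show ?case
    proof
      fix t :: real
      define c0 where "c0 = min (inverse ap) (inverse am)"
      have c0: "c0 > 0" using pos by (simp add: c0_def)
      \<comment> \<open>The factor \<open>exp 1\<close> in the comparison of clocks at time \<open>1\<close> turns this into \<open>c0 / 2\<close>.\<close>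
      have ev1: "\<forall>\<^sub>F n in sequentially.
          clock_defect (?l (r n)) (step_rate ap am) (?V (r n)) \<omega> < ennreal (c0 / 2 / exp 1)"
        by (rule order_tendstoD(2)[OF elim(1)]) (use c0 in simp)
      have ev2: "\<forall>\<^sub>F n in sequentially. t / (c0 / 2) \<le> real n"
        by (rule filterlim_at_top[THEN iffD1, rule_format, OF filterlim_real_sequentially])
      obtain n where
        n: "clock_defect (?l (r n)) (step_rate ap am) (?V (r n)) \<omega> < ennreal (c0 / 2 / exp 1)"
          "t / (c0 / 2) \<le> real n"
        using eventually_happens'[OF sequentially_bot eventually_conj[OF ev1 ev2]] by auto
      have "ennreal (c0 / 2) + ennreal (c0 / 2) = ennreal c0"
        using c0 by (subst ennreal_plus[symmetric]) auto
      also have "\<dots> \<le> clock (step_rate ap am) (?V (r n)) 1 \<omega>"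
        unfolding c0_def by (rule clock_step_rate_1_ge[OF pos(2,3)])
      also have "\<dots> \<le> clock (?l (r n)) (?V (r n)) 1 \<omega> +
          ennreal (exp 1) * clock_defect (step_rate ap am) (?l (r n)) (?V (r n)) \<omega>"
        by (rule clock_le_add_clock_defect)
          (use elim(2) lam_m pos step_pos in \<open>auto intro!: continuous_on_brownian_scaling\<close>)
      also have "\<dots> \<le> clock (?l (r n)) (?V (r n)) 1 \<omega> + ennreal (exp 1) * ennreal (c0 / 2 / exp 1)"
        using n(1) by (intro add_left_mono mult_left_mono) (auto simp: clock_defect_commute[of "step_rate ap am"])
      also have "ennreal (exp 1) * ennreal (c0 / 2 / exp 1) = ennreal (c0 / 2)"
        using c0 by (subst ennreal_mult[symmetric]) auto
      finally have "ennreal (c0 / 2) + ennreal (c0 / 2) \<le>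
          clock (?l (r n)) (?V (r n)) 1 \<omega> + ennreal (c0 / 2)" .
      then have "ennreal (c0 / 2) + ennreal (c0 / 2) \<le>
          ennreal (c0 / 2) + clock (?l (r n)) (?V (r n)) 1 \<omega>"
        by (simp only: add.commute)
      then have ge: "ennreal (c0 / 2) \<le> clock (?l (r n)) (?V (r n)) 1 \<omega>"
        unfolding ennreal_add_left_cancel_le by simp
      have "t \<le> real n * (c0 / 2)" using n(2) c0 by (simp add: pos_divide_le_eq)
      also have "\<dots> \<le> real (Suc (r n)) * (c0 / 2)"
        using c0 strict_mono_imp_increasing[OF r(1), of n] by (intro mult_right_mono) auto
      finally have "ennreal t \<le> ennreal (real (Suc (r n)) * (c0 / 2))" by (rule ennreal_leI)
      also have "\<dots> = ennreal (real (Suc (r n))) * ennreal (c0 / 2)"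
        using c0 by (subst ennreal_mult) auto
      also have "\<dots> \<le> ennreal (real (Suc (r n))) * clock (?l (r n)) (?V (r n)) 1 \<omega>"
        by (intro mult_left_mono ge) simp
      also have "\<dots> = clock lam B (real (Suc (r n)) * 1) \<omega>"
        by (rule clock_brownian_scaling[where B=B and \<omega>=\<omega>, OF elim(2) lam_m, symmetric]) simp
      finally show "\<exists>u. ennreal t \<le> clock lam B u \<omega>" by blast
    qed
  qed
qed

text \<open>Finiteness comes from comparison with the bounded step rate: the reciprocal of \<open>lam\<close> may be
  unbounded, but the defect has finite expectation.\<close>

lemma regular_clock_AE:
  assumes W: "wiener_process M B" and lam: "admissible_rate lam ap am"
  shows "AE \<omega> in M. continuous_on {0..} (\<lambda>s. B s \<omega>) \<and> (\<forall>u. clock lam B u \<omega> < \<infinity>) \<and>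
    regular_clock (\<lambda>u. enn2real (clock lam B u \<omega>))"
proof -
  have lam_m: "lam \<in> borel_measurable borel" and pos: "\<And>x. lam x > 0" "ap > 0" "am > 0"
    using lam by (auto simp: admissible_rate_def)
  have step_pos: "step_rate ap am x > 0" for x using pos by (simp add: step_rate_def)
  from clock_defect_finite_AE[OF W lam] clock_unbounded_AE[OF W lam] wiener_process_continuous_path[OF W]
  show ?thesis
  proof eventually_elim
    case (elim \<omega>)
    have fin: "clock lam B u \<omega> < \<infinity>" for u
    proof -
      have "clock lam B u \<omega> \<le> clock (step_rate ap am) B u \<omega> +
          ennreal (exp u) * clock_defect lam (step_rate ap am) B \<omega>"
        by (rule clock_le_add_clock_defect[where B=B and \<omega>=\<omega>, OF elim(3) lam_m measurable_step_rate pos(1) step_pos])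
      also have "\<dots> < \<infinity>"
        using elim(1) clock_step_rate_finite[OF pos(2,3), of B u \<omega>] by (simp add: ennreal_mult_less_top)
      finally show ?thesis .
    qed
    moreover have "regular_clock (\<lambda>u. enn2real (clock lam B u \<omega>))"
      using elim(2) by (intro regular_clock_enn2real_clock[OF elim(3) lam_m pos(1) fin]) blast
    ultimately show ?case using elim(3) by blast
  qed
qed

lemma tau_cong:
  "(\<And>s. s \<ge> 0 \<Longrightarrow> B s \<omega> = C s \<omega>') \<Longrightarrow> tau lam B t \<omega> = tau lam C t \<omega>'"
  unfolding tau_def by (simp add: clock_cong[of B \<omega> C \<omega>'])

lemma tau_nonneg: "tau lam B t \<omega> \<ge> 0"
  unfolding tau_def by (intro INF_greatest) simp

lemma time_changed_cong:
  assumes "\<And>s. s \<ge> 0 \<Longrightarrow> B s \<omega> = C s \<omega>'"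
  shows "time_changed lam B t \<omega> = time_changed lam C t \<omega>'"
proof -
  have eq: "tau lam B t \<omega> = tau lam C t \<omega>'" by (rule tau_cong) (rule assms)
  show ?thesis
    unfolding time_changed_def eq by (rule assms) (simp add: real_of_ereal_pos tau_nonneg)
qed

text \<open>Since the clock is monotone, the infimum in \<^const>\<open>tau\<close> is below \<open>a\<close> iff some rational time
  below \<open>a\<close> belongs to the set. Composition with the time change is then measurable by joint
  measurability of \<^const>\<open>path_ext\<close>.\<close>

lemma measurable_time_changed_coordinate:
  assumes [measurable]: "lam \<in> borel_measurable borel"
  shows "time_changed lam coordinate_process t \<in> borel_measurable path_space"
proof -
  have [measurable]: "clock lam coordinate_process u \<in> borel_measurable path_space" for u
    unfolding clock_def by measurable
  have "tau lam coordinate_process t \<in> borel_measurable path_space"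
  proof (rule borel_measurableI_less)
    fix a :: ereal
    have "tau lam coordinate_process t y < a \<longleftrightarrow>
        (\<exists>q::rat. 0 < q \<and> ereal (of_rat q) < a \<and> ennreal t < clock lam coordinate_process (of_rat q) y)" for y
    proof
      assume "tau lam coordinate_process t y < a"
      then obtain u where u: "0 < u" "ennreal t < clock lam coordinate_process u y" "ereal u < a"
        unfolding tau_def INF_less_iff by auto
      obtain b where b: "ereal u < ereal b" "ereal b \<le> a"
        using u(3) by (metis ereal_dense2 less_imp_le)
      obtain q where q: "u < of_rat q" "of_rat q < b" using of_rat_dense[of u b] b(1) by auto
      have "ereal (of_rat q) < a" using q b(2) by (meson less_ereal.simps(1) less_le_trans)
      moreover have "0 < q" using u q by (metis less_trans zero_less_of_rat_iff)
      moreover have "ennreal t < clock lam coordinate_process (of_rat q) y"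
        using u(2) clock_mono[of u "of_rat q"] q(1) by (meson less_imp_le less_le_trans)
      ultimately show "\<exists>q::rat. 0 < q \<and> ereal (of_rat q) < a \<and>
          ennreal t < clock lam coordinate_process (of_rat q) y" by blast
    next
      assume "\<exists>q::rat. 0 < q \<and> ereal (of_rat q) < a \<and> ennreal t < clock lam coordinate_process (of_rat q) y"
      then show "tau lam coordinate_process t y < a"
        unfolding tau_def INF_less_iff by (metis (mono_tags, lifting) mem_Collect_eq zero_less_of_rat_iff)
    qed
    then show "{y \<in> space path_space. tau lam coordinate_process t y < a} \<in> sets path_space"
      by simp
  qed
  then show ?thesis
    unfolding time_changed_def by measurable
qed

lemma time_changed_coordinate_AE:
  assumes "wiener_process M B"
  shows "AE \<omega> in M. \<forall>t. time_changed lam B t \<omega> = time_changed lam coordinate_process t (path_of B \<omega>)"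
  using wiener_process_coordinate[OF assms]
  by eventually_elim (auto intro!: time_changed_cong)

lemma continuous_on_time_changed_AE:
  assumes W: "wiener_process M B" and lam: "admissible_rate lam ap am"
  shows "AE \<omega> in M. continuous_on {0..} (\<lambda>t. time_changed lam B t \<omega>)"
  using regular_clock_AE[OF W lam]
proof eventually_elim
  case (elim \<omega>)
  let ?c = "\<lambda>u. enn2real (clock lam B u \<omega>)"
  have c: "regular_clock ?c" and fin: "\<And>u. clock lam B u \<omega> < \<infinity>" using elim by auto
  have "continuous_on {0..} (\<lambda>t. B (inv_into {0..} ?c t) \<omega>)"
    by (rule continuous_on_compose2[of "{0..}" "\<lambda>s. B s \<omega>"])
      (use elim continuous_on_inv_regular_clock[OF c] regular_clock_inv(1)[OF c] in auto)
  then show ?case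
    by (subst continuous_on_cong[OF refl time_changed_eq_inv_clock[OF c fin]]) auto
qed

lemma continuous_process_time_changed:
  assumes W: "wiener_process M B" and lam: "admissible_rate lam ap am" and k: "k \<ge> 0"
  shows "continuous_process T M (\<lambda>t \<omega>. time_changed lam B (k * t) \<omega> / c)"
  unfolding continuous_process_def
proof (intro conjI ballI)
  have [measurable]: "lam \<in> borel_measurable borel" using lam by (simp add: admissible_rate_def)
  show "prob_space M" using W by (simp add: wiener_process_def)
  show "(\<lambda>\<omega>. time_changed lam B (k * t) \<omega> / c) \<in> borel_measurable (completion M)" for t
  proof (rule borel_measurable_completion_AE)
    note [measurable] = measurable_time_changed_coordinate measurable_path_of[OF W]
    have "(\<lambda>\<omega>. time_changed lam coordinate_process (k * t) (path_of B \<omega>) / c) \<in> borel_measurable M"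
      by measurable
    then show "(\<lambda>\<omega>. time_changed lam coordinate_process (k * t) (path_of B \<omega>) / c)
        \<in> borel_measurable (completion M)"
      by (rule measurable_completion)
    show "AE \<omega> in M. time_changed lam coordinate_process (k * t) (path_of B \<omega>) / c =
        time_changed lam B (k * t) \<omega> / c"
      using time_changed_coordinate_AE[OF W, of lam] by eventually_elim simp
  qed
  show "AE \<omega> in M. continuous_on {0..T} (\<lambda>t. time_changed lam B (k * t) \<omega> / c)"
    using continuous_on_time_changed_AE[OF W lam]
  proof eventually_elim
    case (elim \<omega>)
    have "continuous_on {0..T} (\<lambda>t. time_changed lam B (k * t) \<omega>)"
      by (rule continuous_on_compose2[OF elim]) (use k in \<open>auto intro!: continuous_intros\<close>)
    then have "continuous_on {0..T} (\<lambda>t. time_changed lam B (k * t) \<omega> * inverse c)"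
      by (rule continuous_on_mult_right)
    then show ?case by (simp add: divide_inverse)
  qed
qed

section \<open>Weak convergence of the time-changed processes\<close>

lemma path_functional_time_changed_measurable:
  assumes "lam \<in> borel_measurable borel" "0 < T"
  shows "(\<lambda>y. path_functional T f (\<lambda>t. time_changed lam coordinate_process t y)) \<in> borel_measurable path_space"
  by (intro path_functional_measurable assms measurable_time_changed_coordinate)

text \<open>Expresses the expectation through the law of the path on the product space alone.\<close>

lemma integral_time_changed_eq_canonical:
  assumes W: "wiener_process M B" and lam: "admissible_rate lam ap am" and T: "0 < T"
    and f: "continuous_map (mtopology_of (C_space T)) euclideanreal f"
  shows "(\<integral>\<omega>. f (path_map T (time_changed lam B) \<omega>) \<partial>completion M) =
    (\<integral>y. path_functional T f (\<lambda>t. time_changed lam coordinate_process t y) \<partial>distr M path_space (path_of B))"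
    (is "_ = (\<integral>y. ?G y \<partial>_)")
proof -
  have lam_m: "lam \<in> borel_measurable borel" using lam by (simp add: admissible_rate_def)
  have G: "?G \<in> borel_measurable path_space"
    by (rule path_functional_time_changed_measurable[OF lam_m T])
  have G': "(\<lambda>\<omega>. ?G (path_of B \<omega>)) \<in> borel_measurable M"
    by (rule measurable_compose[OF measurable_path_of[OF W] G])
  have "continuous_process T M (time_changed lam B)"
    using continuous_process_time_changed[OF W lam, of 1 T 1] by simp
  note fm = measurable_functional_path_map[OF T this f]
  have "AE \<omega> in M. f (path_map T (time_changed lam B) \<omega>) = ?G (path_of B \<omega>)"
    using continuous_on_time_changed_AE[OF W lam] time_changed_coordinate_AE[OF W, of lam]
  proof eventually_elim
    case (elim \<omega>)
    have "continuous_on {0..T} (\<lambda>t. time_changed lam B t \<omega>)"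
      by (rule continuous_on_subset[OF elim(1)]) auto
    from path_functional_path_map[where X="time_changed lam B" and \<omega>=\<omega>, OF T f this] show ?case using elim(2) by simp
  qed
  then have "AE \<omega> in completion M. f (path_map T (time_changed lam B) \<omega>) = ?G (path_of B \<omega>)"
    by (rule AE_completion)
  then have "(\<integral>\<omega>. f (path_map T (time_changed lam B) \<omega>) \<partial>completion M) =
      (\<integral>\<omega>. ?G (path_of B \<omega>) \<partial>completion M)"
    by (rule integral_cong_AE[OF fm measurable_completion[OF G']])
  also have "\<dots> = (\<integral>\<omega>. ?G (path_of B \<omega>) \<partial>M)"
    by (rule integral_completion[OF G'])
  also have "\<dots> = (\<integral>y. ?G y \<partial>distr M path_space (path_of B))"
    by (rule integral_distr[OF measurable_path_of[OF W] G, symmetric])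
  finally show ?thesis .
qed

lemma time_changed_law_unique:
  assumes W: "wiener_process M B" and W': "wiener_process M' B'"
    and lam: "admissible_rate lam ap am" and T: "0 < T"
    and f: "continuous_map (mtopology_of (C_space T)) euclideanreal f"
  shows "(\<integral>\<omega>. f (path_map T (time_changed lam B) \<omega>) \<partial>completion M) =
    (\<integral>\<omega>. f (path_map T (time_changed lam B') \<omega>) \<partial>completion M')"
  unfolding integral_time_changed_eq_canonical[OF W lam T f]
    integral_time_changed_eq_canonical[OF W' lam T f] wiener_process_law_unique[OF W W'] ..

text \<open>The space-time scaling of the problem: it moves the index \<open>n\<close> of the sequence from the process into
  the rate.\<close>

lemma time_changed_brownian_scaling_AE:
  assumes W: "wiener_process M B" and lam: "admissible_rate lam ap am" and k: "k > 0"
  shows "AE \<omega> in M. \<forall>t\<ge>0. time_changed lam B (k * t) \<omega> / sqrt k =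
    time_changed (\<lambda>x. lam (sqrt k * x)) (brownian_scaling k B) t \<omega>"
proof -
  let ?l = "\<lambda>x. lam (sqrt k * x)" and ?B = "brownian_scaling k B"
  have lam_m: "lam \<in> borel_measurable borel" using lam by (simp add: admissible_rate_def)
  have "admissible_rate ?l ap am" by (rule admissible_rate_mult[OF lam]) (use k in simp)
  note reg = regular_clock_AE[OF wiener_process_brownian_scaling[OF W k] this]
  from regular_clock_AE[OF W lam] reg show ?thesis
  proof eventually_elim
    case (elim \<omega>)
    let ?c = "\<lambda>u. enn2real (clock lam B u \<omega>)" and ?d = "\<lambda>u. enn2real (clock ?l ?B u \<omega>)"
    have c: "regular_clock ?c" "\<And>u. clock lam B u \<omega> < \<infinity>" and B: "continuous_on {0..} (\<lambda>s. B s \<omega>)"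
      and d: "regular_clock ?d" "\<And>u. clock ?l ?B u \<omega> < \<infinity>"
      using elim by auto
    have cd: "?c (k * u) = k * ?d u" for u
      using clock_brownian_scaling[where B=B and \<omega>=\<omega> and u=u, OF B lam_m k] k by (simp add: enn2real_mult)
    show ?case
    proof (intro allI impI)
      fix t :: real assume t: "t \<ge> 0"
      have inv: "inv_into {0..} ?c (k * t) = k * inv_into {0..} ?d t"
        by (rule regular_clock_inv_eqI[OF c(1)])
          (use regular_clock_inv[OF d(1) t] k in \<open>auto simp: cd\<close>)
      have "time_changed lam B (k * t) \<omega> = B (inv_into {0..} ?c (k * t)) \<omega>"
        by (rule time_changed_eq_inv_clock[OF c]) (use k t in simp)
      moreover have "time_changed ?l ?B t \<omega> = ?B (inv_into {0..} ?d t) \<omega>"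
        by (rule time_changed_eq_inv_clock[OF d t])
      ultimately show "time_changed lam B (k * t) \<omega> / sqrt k = time_changed ?l ?B t \<omega>"
        by (simp add: inv brownian_scaling_def)
    qed
  qed
qed

lemma path_map_cong:
  assumes "\<And>t. t \<in> {0..T} \<Longrightarrow> X t \<omega> = Y t \<omega>"
  shows "path_map T X \<omega> = path_map T Y \<omega>"
proof -
  have "continuous_on {0..T} (\<lambda>t. X t \<omega>) \<longleftrightarrow> continuous_on {0..T} (\<lambda>t. Y t \<omega>)"
    by (rule continuous_on_cong[OF refl assms])
  moreover have "restrict (\<lambda>t. X t \<omega>) {0..T} = restrict (\<lambda>t. Y t \<omega>) {0..T}"
    by (rule restrict_ext[OF assms])
  ultimately show ?thesis by (simp only: path_map_def)
qed

lemma integral_path_map_cong_AE: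
  assumes T: "0 < T" and X: "continuous_process T M X" and Y: "continuous_process T M Y"
    and f: "continuous_map (mtopology_of (C_space T)) euclideanreal f"
    and ae: "AE \<omega> in M. \<forall>t\<in>{0..T}. X t \<omega> = Y t \<omega>"
  shows "(\<integral>\<omega>. f (path_map T X \<omega>) \<partial>completion M) = (\<integral>\<omega>. f (path_map T Y \<omega>) \<partial>completion M)"
proof (rule integral_cong_AE)
  show "AE \<omega> in completion M. f (path_map T X \<omega>) = f (path_map T Y \<omega>)"
  proof (rule AE_completion)
    show "AE \<omega> in M. f (path_map T X \<omega>) = f (path_map T Y \<omega>)"
      using ae by eventually_elim (auto intro!: arg_cong[of _ _ f] path_map_cong)
  qed
qed (rule measurable_functional_path_map[OF T _ f] X Y)+

text \<open>Where the defect tends to \<open>0\<close>, the clocks converge locally uniformly; hence so do their inverses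
  and, by uniform continuity of the path on bounded intervals, the time-changed paths.\<close>

lemma time_changed_subseq_AE_uniform_limit:
  assumes W: "wiener_process M B" and lam: "admissible_rate lam ap am" and T: "0 < T"
    and c: "\<And>n. c n > 0" "filterlim c at_top sequentially"
  shows "\<exists>r. strict_mono r \<and> (AE \<omega> in M.
    uniform_limit {0..T} (\<lambda>n t. time_changed (\<lambda>x. lam (c (r n) * x)) B t \<omega>)
      (\<lambda>t. time_changed (step_rate ap am) B t \<omega>) sequentially)"
proof -
  have M: "prob_space M" using W by (simp add: wiener_process_def)
  have lam_m [measurable]: "lam \<in> borel_measurable borel" and pos: "\<And>x. lam x > 0" "ap > 0" "am > 0"
    using lam by (auto simp: admissible_rate_def)
  have step_pos: "step_rate ap am x > 0" for x using pos by (simp add: step_rate_def)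
  let ?l = "\<lambda>n x. lam (c n * x)"
  have l_m: "?l n \<in> borel_measurable borel" for n by measurable
  obtain r where r: "strict_mono r"
    "AE \<omega> in M. (\<lambda>n. clock_defect (?l (r n)) (step_rate ap am) B \<omega>) \<longlonglongrightarrow> 0"
    using clock_defect_subseq_AE_tendsto_0[where V="\<lambda>_. B" and c=c, OF M W lam c] by blast
  have reg: "AE \<omega> in M. \<forall>n. (\<forall>u. clock (?l (r n)) B u \<omega> < \<infinity>) \<and>
      regular_clock (\<lambda>u. enn2real (clock (?l (r n)) B u \<omega>))"
    unfolding AE_all_countable
  proof
    fix n
    show "AE \<omega> in M. (\<forall>u. clock (?l (r n)) B u \<omega> < \<infinity>) \<and>
      regular_clock (\<lambda>u. enn2real (clock (?l (r n)) B u \<omega>))"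
      using regular_clock_AE[OF W admissible_rate_mult[OF lam c(1)[of "r n"]]] by eventually_elim blast
  qed
  have "AE \<omega> in M. uniform_limit {0..T} (\<lambda>n t. time_changed (?l (r n)) B t \<omega>)
      (\<lambda>t. time_changed (step_rate ap am) B t \<omega>) sequentially"
    using r(2) reg regular_clock_AE[OF W admissible_step_rate[OF pos(2,3)]]
  proof eventually_elim
    case (elim \<omega>)
    let ?D = "\<lambda>n. clock_defect (?l (r n)) (step_rate ap am) B \<omega>"
    let ?C = "\<lambda>n u. enn2real (clock (?l (r n)) B u \<omega>)"
    let ?c = "\<lambda>u. enn2real (clock (step_rate ap am) B u \<omega>)"
    have C: "regular_clock (?C n)" "\<And>u. clock (?l (r n)) B u \<omega> < \<infinity>" for n using elim(2) by auto
    have c': "regular_clock ?c" "\<And>u. clock (step_rate ap am) B u \<omega> < \<infinity>"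
      and B: "continuous_on {0..} (\<lambda>s. B s \<omega>)" using elim(3) by auto
    have "uniform_limit {0..U} ?C ?c sequentially" for U
    proof (rule uniform_limitI)
      fix e :: real assume e: "e > 0"
      have "\<forall>\<^sub>F n in sequentially. ?D n < ennreal (e / exp U)"
        by (rule order_tendstoD(2)[OF elim(1)]) (use e in simp)
      then show "\<forall>\<^sub>F n in sequentially. \<forall>u\<in>{0..U}. dist (?C n u) (?c u) < e"
      proof eventually_elim
        case (elim n)
        define d where "d = enn2real (?D n)"
        have "?D n < \<infinity>" using elim by (rule less_trans) simp
        then have D: "?D n = ennreal d" by (simp add: d_def)
        have d0: "d \<ge> 0" by (simp add: d_def)
        have d: "d < e / exp U" using elim d0 e by (simp add: D ennreal_less_iff)
        show ?case
        proof
          fix u assume u: "u \<in> {0..U}"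
          have "clock (?l (r n)) B u \<omega> \<le> clock (step_rate ap am) B u \<omega> + ennreal (exp u) * ?D n"
            by (rule clock_le_add_clock_defect[where B=B and \<omega>=\<omega>,
                OF B l_m measurable_step_rate pos(1) step_pos])
          then have "ennreal (?C n u) \<le> ennreal (?c u + exp u * d)"
            using C(2)[of n u] c'(2)[of u] d0 by (simp add: D ennreal_mult ennreal_plus)
          then have 1: "?C n u \<le> ?c u + exp u * d"
            using d0 by (subst (asm) ennreal_le_iff) auto
          have "clock (step_rate ap am) B u \<omega> \<le> clock (?l (r n)) B u \<omega> +
              ennreal (exp u) * clock_defect (step_rate ap am) (?l (r n)) B \<omega>"
            by (rule clock_le_add_clock_defect[where B=B and \<omega>=\<omega>,
                OF B measurable_step_rate l_m step_pos pos(1)])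
          then have "clock (step_rate ap am) B u \<omega> \<le> clock (?l (r n)) B u \<omega> + ennreal (exp u) * ?D n"
            by (simp only: clock_defect_commute[of "step_rate ap am"])
          then have "ennreal (?c u) \<le> ennreal (?C n u + exp u * d)"
            using C(2)[of n u] c'(2)[of u] d0 by (simp add: D ennreal_mult ennreal_plus)
          then have 2: "?c u \<le> ?C n u + exp u * d"
            using d0 by (subst (asm) ennreal_le_iff) auto
          have "exp u * d \<le> exp U * d" using u d0 by (intro mult_right_mono) auto
          also have "\<dots> < e" using d by (simp add: pos_less_divide_eq mult.commute)
          finally show "dist (?C n u) (?c u) < e"
            using 1 2 unfolding dist_real_def abs_less_iff by linarith
        qed
      qed
    qed
    then have "uniform_limit {0..T} (\<lambda>n t. B (inv_into {0..} (?C n) t) \<omega>)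
        (\<lambda>t. B (inv_into {0..} ?c t) \<omega>) sequentially"
      using T by (intro uniform_limit_time_change[where w="\<lambda>s. B s \<omega>", OF B C(1) c'(1)]) auto
    moreover have "B (inv_into {0..} (?C n) t) \<omega> = time_changed (?l (r n)) B t \<omega>" if "t \<in> {0..T}" for n t
      using time_changed_eq_inv_clock[where B=B and \<omega>=\<omega>, OF C, of t n] that by simp
    moreover have "B (inv_into {0..} ?c t) \<omega> = time_changed (step_rate ap am) B t \<omega>" if "t \<in> {0..T}" for t
      using time_changed_eq_inv_clock[where B=B and \<omega>=\<omega>, OF c', of t] that by simp
    ultimately show ?case
      by (subst (asm) uniform_limit_cong'[where X="{0..T}"]) auto
  qed
  with r(1) show ?thesis by blast
qed

lemma LIMSEQ_if_subseq_subseq: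
  fixes a :: "nat \<Rightarrow> 'a::metric_space"
  assumes "\<And>s :: nat \<Rightarrow> nat. strict_mono s \<Longrightarrow> \<exists>r :: nat \<Rightarrow> nat. strict_mono r \<and> (\<lambda>n. a (s (r n))) \<longlonglongrightarrow> l"
  shows "a \<longlonglongrightarrow> l"
proof (rule ccontr)
  assume "\<not> a \<longlonglongrightarrow> l"
  then obtain e where e: "e > 0" "\<And>N. \<exists>n\<ge>N. dist (a n) l \<ge> e"
    unfolding lim_sequentially by (auto simp: not_less)
  then have "infinite {n. dist (a n) l \<ge> e}"
    unfolding infinite_nat_iff_unbounded_le by auto
  from infinite_enumerate[OF this] obtain s :: "nat \<Rightarrow> nat" where
    s: "strict_mono s" "\<And>n. dist (a (s n)) l \<ge> e" by auto
  obtain r :: "nat \<Rightarrow> nat" where r: "(\<lambda>n. a (s (r n))) \<longlonglongrightarrow> l"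
    using assms[OF s(1)] by blast
  have "\<forall>\<^sub>F n in sequentially. dist (a (s (r n))) l < e" by (rule tendstoD[OF r e(1)])
  then have "\<forall>\<^sub>F n :: nat in sequentially. False"
    by eventually_elim (use s(2) in \<open>auto simp: not_less[symmetric]\<close>)
  then show False by simp
qed

text \<open>Almost sure convergence is available only along subsequences of a given subsequence, but this
  suffices for the convergence of real numbers, here of the expectations.\<close>

lemma time_changed_rescaled_weak_limit:
  assumes W: "wiener_process M B" and lam: "admissible_rate lam ap am" and T: "0 < T"
    and c: "\<And>n. c n > 0" "filterlim c at_top sequentially"
    and f: "continuous_map (mtopology_of (C_space T)) euclideanreal f"
    and bdd: "bounded (f ` topspace (mtopology_of (C_space T)))"
  shows "(\<lambda>n. \<integral>\<omega>. f (path_map T (time_changed (\<lambda>x. lam (c n * x)) B) \<omega>) \<partial>completion M) \<longlonglongrightarrow>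
    (\<integral>\<omega>. f (path_map T (time_changed (step_rate ap am) B) \<omega>) \<partial>completion M)"
proof (rule LIMSEQ_if_subseq_subseq)
  fix s :: "nat \<Rightarrow> nat" assume s: "strict_mono s"
  interpret prob_space M using W by (simp add: wiener_process_def)
  interpret C: prob_space "completion M" by (rule prob_space_completion)
  let ?X = "\<lambda>n. time_changed (\<lambda>x. lam (c n * x)) B"
  let ?Y = "time_changed (step_rate ap am) B"
  have adm: "admissible_rate (\<lambda>x. lam (c n * x)) ap am" for n by (rule admissible_rate_mult[OF lam c(1)])
  have adm': "admissible_rate (step_rate ap am) ap am"
    using lam by (intro admissible_step_rate) (auto simp: admissible_rate_def)
  have X: "continuous_process T M (?X n)" for n
    using continuous_process_time_changed[OF W adm, of 1 T n 1] by simp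
  have Y: "continuous_process T M ?Y"
    using continuous_process_time_changed[OF W adm', of 1 T 1] by simp
  have "filterlim (\<lambda>n. c (s n)) at_top sequentially"
    by (rule filterlim_compose[OF c(2) filterlim_subseq[OF s]])
  then obtain r where r: "strict_mono r"
    "AE \<omega> in M. uniform_limit {0..T} (\<lambda>n t. ?X (s (r n)) t \<omega>) (\<lambda>t. ?Y t \<omega>) sequentially"
    using time_changed_subseq_AE_uniform_limit[where c="\<lambda>n. c (s n)", OF W lam T c(1)] by blast
  obtain K where K: "\<And>y. y \<in> mspace (C_space T) \<Longrightarrow> \<bar>f y\<bar> \<le> K"
    using bdd by (auto simp: bounded_iff)
  have cont: "AE \<omega> in M. \<forall>n. continuous_on {0..T} (\<lambda>t. ?X n t \<omega>)"
    using X by (simp add: AE_all_countable continuous_process_def)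
  have contY: "AE \<omega> in M. continuous_on {0..T} (\<lambda>t. ?Y t \<omega>)"
    using Y by (simp add: continuous_process_def)
  have "(\<lambda>n. \<integral>\<omega>. f (path_map T (?X (s (r n))) \<omega>) \<partial>completion M) \<longlonglongrightarrow>
      (\<integral>\<omega>. f (path_map T ?Y \<omega>) \<partial>completion M)"
  proof (rule integral_dominated_convergence[where w="\<lambda>_. K"])
    show "(\<lambda>\<omega>. f (path_map T ?Y \<omega>)) \<in> borel_measurable (completion M)"
      by (rule measurable_functional_path_map[OF T Y f])
    show "(\<lambda>\<omega>. f (path_map T (?X (s (r n))) \<omega>)) \<in> borel_measurable (completion M)" for n
      by (rule measurable_functional_path_map[OF T X f])
    show "AE \<omega> in completion M. (\<lambda>n. f (path_map T (?X (s (r n))) \<omega>)) \<longlonglongrightarrow> f (path_map T ?Y \<omega>)"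
    proof (rule AE_completion)
      show "AE \<omega> in M. (\<lambda>n. f (path_map T (?X (s (r n))) \<omega>)) \<longlonglongrightarrow> f (path_map T ?Y \<omega>)"
        using r(2) cont contY
      proof eventually_elim
        case (elim \<omega>)
        have "(\<lambda>n. f (restrict (\<lambda>t. ?X (s (r n)) t \<omega>) {0..T})) \<longlonglongrightarrow> f (restrict (\<lambda>t. ?Y t \<omega>) {0..T})"
          by (rule continuous_functional_LIMSEQ[OF f elim(3) _ elim(1)]) (use elim(2) in blast)
        then show ?case using elim(2,3) by (simp add: path_map_eq_restrict)
      qed
    qed
    show "AE \<omega> in completion M. norm (f (path_map T (?X (s (r n))) \<omega>)) \<le> K" for n
      by (intro AE_I2) (simp add: K path_map_in_C_space)
  qed simp
  with r(1) show "\<exists>r. strict_mono r \<and> (\<lambda>n. \<integral>\<omega>. f (path_map T (?X (s (r n))) \<omega>) \<partial>completion M) \<longlonglongrightarrow>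
      (\<integral>\<omega>. f (path_map T ?Y \<omega>) \<partial>completion M)"
    by blast
qed

text \<open>\<^const>\<open>nu\<close> and the reciprocal of the step rate differ only at \<open>0\<close>, where the path spends no
  time. In particular \<^const>\<open>eta\<close> increases strictly although \<^const>\<open>nu\<close> vanishes at \<open>0\<close>.\<close>

lemma eta_eq_clock_AE:
  assumes W: "wiener_process M B" and pos: "0 < ap" "0 < am"
  shows "AE \<omega> in M. \<forall>t. eta ap am B t \<omega> = enn2real (clock (step_rate ap am) B t \<omega>)"
  using wiener_process_zero_set_null[OF W] wiener_process_continuous_path[OF W]
proof eventually_elim
  case (elim \<omega>)
  show ?case
  proof
    fix t
    define p where "p s = B (max 0 s) \<omega>" for s
    have [measurable]: "p \<in> borel_measurable borel"
      unfolding p_def by (rule borel_measurable_extended_path[OF elim(2)])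
    have [measurable]: "nu ap am \<in> borel_measurable borel" unfolding nu_def by measurable
    have nn: "nu ap am x \<ge> 0" for x using pos by (simp add: nu_def indicator_def)
    have "eta ap am B t \<omega> = (\<integral>s. indicator {0..t} s *\<^sub>R nu ap am (p s) \<partial>lborel)"
      unfolding eta_def set_lebesgue_integral_def
      by (intro Bochner_Integration.integral_cong) (auto simp: p_def indicator_def)
    also have "\<dots> = enn2real (\<integral>\<^sup>+s. ennreal (indicator {0..t} s *\<^sub>R nu ap am (p s)) \<partial>lborel)"
      by (rule integral_eq_nn_integral) (use nn in auto)
    also have "(\<integral>\<^sup>+s. ennreal (indicator {0..t} s *\<^sub>R nu ap am (p s)) \<partial>lborel) =
        clock (step_rate ap am) B t \<omega>"
      unfolding clock_def
    proof (rule nn_integral_cong_AE)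
      show "AE s in lborel. ennreal (indicator {0..t} s *\<^sub>R nu ap am (p s)) =
          ennreal (inverse (step_rate ap am (B s \<omega>))) * indicator {0..t} s"
        using elim(1)
      proof eventually_elim
        case (elim s)
        then show ?case
          by (auto simp: p_def indicator_def nu_def step_rate_def inverse_eq_divide)
      qed
    qed
    finally show "eta ap am B t \<omega> = enn2real (clock (step_rate ap am) B t \<omega>)" .
  qed
qed

lemma eta_regular_clock_AE:
  assumes W: "wiener_process M B" and pos: "0 < ap" "0 < am"
  shows "AE \<omega> in M. regular_clock (\<lambda>t. eta ap am B t \<omega>)"
  using eta_eq_clock_AE[OF W pos] regular_clock_AE[OF W admissible_step_rate[OF pos]]
proof eventually_elim
  case (elim \<omega>)
  then have "(\<lambda>t. eta ap am B t \<omega>) = (\<lambda>t. enn2real (clock (step_rate ap am) B t \<omega>))" by auto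
  then show ?case using elim by simp
qed

lemma time_changed_step_rate_eq_eta_inv_AE:
  assumes W: "wiener_process M B" and pos: "0 < ap" "0 < am"
  shows "AE \<omega> in M. \<forall>t\<ge>0. time_changed (step_rate ap am) B t \<omega> = B (eta_inv ap am B t \<omega>) \<omega>"
  using eta_eq_clock_AE[OF W pos] regular_clock_AE[OF W admissible_step_rate[OF pos]]
proof eventually_elim
  case (elim \<omega>)
  then have eq: "(\<lambda>t. eta ap am B t \<omega>) = (\<lambda>t. enn2real (clock (step_rate ap am) B t \<omega>))" by auto
  show ?case
    unfolding eta_inv_def eq using elim by (auto intro!: time_changed_eq_inv_clock)
qed

theorem theorem2p4:
  fixes P :: "'a measure" and Q :: "'b measure"
    and B :: "real \<Rightarrow> 'a \<Rightarrow> real" and W :: "real \<Rightarrow> 'b \<Rightarrow> real"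
    and lam :: "real \<Rightarrow> real" and ap am T :: real
  assumes "lam \<in> borel_measurable borel"
    and "\<And>x. 0 < lam x"
    and "\<And>K. compact K \<Longrightarrow> set_integrable lborel K (\<lambda>x. 1 / lam x)"
    and "0 < ap" and "0 < am"
    and "(lam \<longlongrightarrow> ap) at_top"
    and "(lam \<longlongrightarrow> am) at_bot"
    and "wiener_process P B"
    and "wiener_process Q W"
    and "0 < T"
  shows "(AE \<omega> in Q. continuous_on {0..} (\<lambda>t. eta ap am W t \<omega>) \<and>
                      strict_mono_on {0..} (\<lambda>t. eta ap am W t \<omega>)) \<and>
         processes_converge_weakly T
           P (\<lambda>n t \<omega>. time_changed lam B (real n * t) \<omega> / sqrt (real n))
           Q (\<lambda>t \<omega>. W (eta_inv ap am W t \<omega>) \<omega>)"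
proof
  have lam: "admissible_rate lam ap am" using assms(1-7) by (simp add: admissible_rate_def)
  note pos = assms(4,5) and B = assms(8) and W = assms(9) and T = assms(10)
  show "AE \<omega> in Q. continuous_on {0..} (\<lambda>t. eta ap am W t \<omega>) \<and> strict_mono_on {0..} (\<lambda>t. eta ap am W t \<omega>)"
    using eta_regular_clock_AE[OF W pos] by eventually_elim (simp add: regular_clock_def)
  let ?X = "\<lambda>n t \<omega>. time_changed lam B (real n * t) \<omega> / sqrt (real n)"
  let ?Y = "\<lambda>t \<omega>. W (eta_inv ap am W t \<omega>) \<omega>"
  let ?Z = "time_changed (step_rate ap am) W"
  have X: "continuous_process T P (?X n)" for n
    by (rule continuous_process_time_changed[OF B lam]) simp
  have Z: "continuous_process T Q ?Z"
    using continuous_process_time_changed[OF W admissible_step_rate[OF pos], of 1 T 1] by simp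
  have YZ: "AE \<omega> in Q. \<forall>t\<in>{0..T}. ?Z t \<omega> = ?Y t \<omega>"
    using time_changed_step_rate_eq_eta_inv_AE[OF W pos] by eventually_elim simp
  have Y: "continuous_process T Q ?Y"
    unfolding continuous_process_def
  proof (intro conjI ballI)
    show "prob_space Q" using W by (simp add: wiener_process_def)
    fix t assume t: "t \<in> {0..T}"
    show "?Y t \<in> borel_measurable (completion Q)"
    proof (rule borel_measurable_completion_AE)
      show "?Z t \<in> borel_measurable (completion Q)" using Z t by (simp add: continuous_process_def)
      show "AE \<omega> in Q. ?Z t \<omega> = ?Y t \<omega>" using YZ by eventually_elim (use t in blast)
    qed
  next
    have "AE \<omega> in Q. continuous_on {0..T} (\<lambda>t. ?Z t \<omega>)" using Z by (simp add: continuous_process_def)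
    with YZ show "AE \<omega> in Q. continuous_on {0..T} (\<lambda>t. ?Y t \<omega>)"
    proof eventually_elim
      case (elim \<omega>)
      have "continuous_on {0..T} (\<lambda>t. ?Z t \<omega>) \<longleftrightarrow> continuous_on {0..T} (\<lambda>t. ?Y t \<omega>)"
        by (rule continuous_on_cong[OF refl]) (use elim(1) in blast)
      then show ?case using elim(2) by blast
    qed
  qed
  have "weakly_converges (mtopology_of (C_space T)) (\<lambda>n. path_law T P (?X n)) (path_law T Q ?Y)"
    unfolding weakly_converges_def
  proof (intro allI impI, elim conjE)
    fix f assume f: "continuous_map (mtopology_of (C_space T)) euclideanreal f"
      and bdd: "bounded (f ` topspace (mtopology_of (C_space T)))"
    let ?l = "\<lambda>n x. lam (sqrt (real (Suc n)) * x)"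
    have "(\<integral>y. f y \<partial>path_law T P (?X (Suc n))) =
        (\<integral>\<omega>. f (path_map T (time_changed (?l n) W) \<omega>) \<partial>completion Q)" for n
    proof -
      let ?B = "brownian_scaling (real (Suc n)) B"
      have VB: "wiener_process P ?B" by (rule wiener_process_brownian_scaling[OF B]) simp
      have adm: "admissible_rate (?l n) ap am" by (rule admissible_rate_mult[OF lam]) simp
      have "(\<integral>y. f y \<partial>path_law T P (?X (Suc n))) = (\<integral>\<omega>. f (path_map T (?X (Suc n)) \<omega>) \<partial>completion P)"
        by (rule integral_path_law[OF T X f])
      also have "\<dots> = (\<integral>\<omega>. f (path_map T (time_changed (?l n) ?B) \<omega>) \<partial>completion P)"
      proof (rule integral_path_map_cong_AE[OF T X _ f])
        show "continuous_process T P (time_changed (?l n) ?B)"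
          using continuous_process_time_changed[OF VB adm, of 1 T 1] by simp
        have "AE \<omega> in P. \<forall>t\<ge>0. ?X (Suc n) t \<omega> = time_changed (?l n) ?B t \<omega>"
          by (rule time_changed_brownian_scaling_AE[OF B lam]) simp
        then show "AE \<omega> in P. \<forall>t\<in>{0..T}. ?X (Suc n) t \<omega> = time_changed (?l n) ?B t \<omega>"
          by eventually_elim simp
      qed
      also have "\<dots> = (\<integral>\<omega>. f (path_map T (time_changed (?l n) W) \<omega>) \<partial>completion Q)"
        by (rule time_changed_law_unique[OF VB W adm T f])
      finally show ?thesis .
    qed
    moreover have "(\<integral>y. f y \<partial>path_law T Q ?Y) = (\<integral>\<omega>. f (path_map T ?Z \<omega>) \<partial>completion Q)"
    proof -
      have "(\<integral>y. f y \<partial>path_law T Q ?Y) = (\<integral>\<omega>. f (path_map T ?Y \<omega>) \<partial>completion Q)"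
        by (rule integral_path_law[OF T Y f])
      also have "\<dots> = (\<integral>\<omega>. f (path_map T ?Z \<omega>) \<partial>completion Q)"
        by (rule integral_path_map_cong_AE[OF T Z Y f YZ, symmetric])
      finally show ?thesis .
    qed
    moreover have "(\<lambda>n. \<integral>\<omega>. f (path_map T (time_changed (?l n) W) \<omega>) \<partial>completion Q) \<longlonglongrightarrow>
        (\<integral>\<omega>. f (path_map T ?Z \<omega>) \<partial>completion Q)"
    proof (rule time_changed_rescaled_weak_limit[OF W lam T _ _ f bdd])
      show "filterlim (\<lambda>n. sqrt (real (Suc n))) at_top sequentially"
        by (intro filterlim_compose[OF sqrt_at_top] filterlim_compose[OF filterlim_real_sequentially filterlim_Suc])
    qed simp
    \<comment> \<open>The index is shifted because the scaling factor \<open>real n\<close> has to be positive.\<close>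
    ultimately have "(\<lambda>n. \<integral>y. f y \<partial>path_law T P (?X (Suc n))) \<longlonglongrightarrow> (\<integral>y. f y \<partial>path_law T Q ?Y)"
      by (simp only:)
    then show "(\<lambda>n. \<integral>y. f y \<partial>path_law T P (?X n)) \<longlonglongrightarrow> (\<integral>y. f y \<partial>path_law T Q ?Y)"
      by (rule LIMSEQ_imp_Suc)
  qed
  then show "processes_converge_weakly T P ?X Q ?Y"
    unfolding processes_converge_weakly_def using X Y by blast
qed

end
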